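(* The conjugacy problem is solvable in amalgams of finite groups. Namely, let $G=G_1\ast_A G_2$ be an amalgam of finite groups. There is an algorithm which, given elements $k,h\in G$, decides whether there exists $g\in G$ such that $gkg^{-1}=h$ in $G$.
   Context: $G=G_1\ast_A G_2$ is a free product with amalgamation, where $G_1=\langle X_1\mid R_1\rangle$ and $G_2=\langle X_2\mid R_2\rangle$ are finite groups given by finite presentations with $X_1^{\pm}\cap X_2^{\pm}=\emptyset$, $A$ is a group generated by $Y$ with monomorphisms $\phi_i:A\to G_i$ ($i=1,2$), and $G=\langle X_1\cup X_2\mid R_1,R_2,\ \phi_1(a)=\phi_2(a)\ (a\in Y)\rangle$. The amalgam (the finite groups $G_1,G_2,A$, their presentations, the monomorphisms) is fixed and known to the algorithm. Elements of $G$ are input as words in the letters $X^{\pm}$, where $X=X_1\cup X_2$. *)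

theory Defs
  imports "HOL-Algebra.Generated_Groups" "HOL-Library.Nat_Bijection"
begin

section \<open>Words and group presentations\<close>

text \<open>The letter \<open>(x, True)\<close> stands for the generator \<open>x\<close>, and \<open>(x, False)\<close> for its formal
  inverse. Words are arbitrary, not necessarily freely reduced.\<close>

type_synonym 'x letter = "'x \<times> bool"
type_synonym 'x word = "'x letter list"

definition letters :: "'x set \<Rightarrow> 'x letter set" where
  "letters X = X \<times> UNIV"

definition words :: "'x set \<Rightarrow> 'x word set" where
  "words X = lists (letters X)"

definition letter_inv :: "'x letter \<Rightarrow> 'x letter" where
  "letter_inv l = (fst l, \<not> snd l)"

definition word_inv :: "'x word \<Rightarrow> 'x word" where
  "word_inv w = rev (map letter_inv w)"

text \<open>Equality of words in the group presented by \<open>X\<close> and \<open>R\<close>: the congruence on words over \<open>X\<close>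
  generated by free cancellation and deletion of relators.\<close>

inductive pres_eq :: "'x set \<Rightarrow> 'x word set \<Rightarrow> 'x word \<Rightarrow> 'x word \<Rightarrow> bool"
  for X :: "'x set" and R :: "'x word set" where
  refl: "u \<in> words X \<Longrightarrow> pres_eq X R u u"
| sym: "pres_eq X R u v \<Longrightarrow> pres_eq X R v u"
| trans: "pres_eq X R u v \<Longrightarrow> pres_eq X R v w \<Longrightarrow> pres_eq X R u w"
| cancel: "u \<in> words X \<Longrightarrow> v \<in> words X \<Longrightarrow> l \<in> letters X \<Longrightarrow>
    pres_eq X R (u @ [l, letter_inv l] @ v) (u @ v)"
| relator: "u \<in> words X \<Longrightarrow> v \<in> words X \<Longrightarrow> r \<in> R \<Longrightarrow> pres_eq X R (u @ r @ v) (u @ v)"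

definition word_class :: "'x set \<Rightarrow> 'x word set \<Rightarrow> 'x word \<Rightarrow> 'x word set" where
  "word_class X R w = {v. pres_eq X R w v}"

definition presented_group :: "'x set \<Rightarrow> 'x word set \<Rightarrow> 'x word set monoid" where
  "presented_group X R =
    \<lparr>carrier = word_class X R ` words X,
     mult = (\<lambda>U V. \<Union>u\<in>U. \<Union>v\<in>V. word_class X R (u @ v)),
     one = word_class X R []\<rparr>"

lemma words_Nil [simp]: "[] \<in> words X"
  by (simp add: words_def)

lemma words_append [simp]: "u @ v \<in> words X \<longleftrightarrow> u \<in> words X \<and> v \<in> words X"
  by (auto simp: words_def)

lemma words_Cons [simp]: "l # v \<in> words X \<longleftrightarrow> l \<in> letters X \<and> v \<in> words X"
  by (auto simp: words_def)

lemma letter_inv_in [simp]: "letter_inv l \<in> letters X \<longleftrightarrow> l \<in> letters X"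
  by (auto simp: letter_inv_def letters_def mem_Times_iff)

lemma letter_inv_inv [simp]: "letter_inv (letter_inv l) = l"
  by (simp add: letter_inv_def)

lemma word_inv_in [simp]: "word_inv w \<in> words X \<longleftrightarrow> w \<in> words X"
  by (induction w) (auto simp: word_inv_def)

lemma pres_eq_words:
  assumes "R \<subseteq> words X" "pres_eq X R u v"
  shows "u \<in> words X \<and> v \<in> words X"
  using assms(2,1) by induction auto

lemma pres_eq_append_left:
  assumes "pres_eq X R u v" "w \<in> words X"
  shows "pres_eq X R (w @ u) (w @ v)"
  using assms
proof induction
  case (cancel u v l)
  then show ?case using pres_eq.cancel[of "w @ u" X v l R] by simp
next
  case (relator u v r)
  then show ?case using pres_eq.relator[of "w @ u" X v r R] by simp
qed (auto intro: pres_eq.intros)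

lemma pres_eq_append_right:
  assumes "pres_eq X R u v" "w \<in> words X"
  shows "pres_eq X R (u @ w) (v @ w)"
  using assms
proof induction
  case (cancel u v l)
  then show ?case using pres_eq.cancel[of u X "v @ w" l R] by simp
next
  case (relator u v r)
  then show ?case using pres_eq.relator[of u X "v @ w" r R] by simp
qed (auto intro: pres_eq.intros)

lemma pres_eq_append:
  assumes "R \<subseteq> words X" "pres_eq X R u u'" "pres_eq X R v v'"
  shows "pres_eq X R (u @ v) (u' @ v')"
  using assms pres_eq_words[OF assms(1)]
  by (meson pres_eq_append_left pres_eq_append_right pres_eq.trans)

lemma word_class_eq_iff:
  assumes "u \<in> words X"
  shows "word_class X R u = word_class X R v \<longleftrightarrow> pres_eq X R u v"
  unfolding word_class_def using assms by (blast intro: pres_eq.intros)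

lemma presented_group_mult:
  assumes "R \<subseteq> words X" "u \<in> words X" "v \<in> words X"
  shows "word_class X R u \<otimes>\<^bsub>presented_group X R\<^esub> word_class X R v = word_class X R (u @ v)"
  using assms unfolding presented_group_def word_class_def
  by (auto intro: pres_eq.intros pres_eq_append)

lemma pres_eq_word_inv: "w \<in> words X \<Longrightarrow> pres_eq X R (word_inv w @ w) []"
proof (induction w)
  case Nil
  then show ?case by (simp add: word_inv_def pres_eq.refl)
next
  case (Cons l w)
  have "pres_eq X R (word_inv w @ [letter_inv l, letter_inv (letter_inv l)] @ w) (word_inv w @ w)"
    using Cons.prems by (intro pres_eq.cancel) auto
  then show ?case using Cons by (auto simp: word_inv_def intro: pres_eq.trans)
qed

lemma group_presented_group:
  assumes R: "R \<subseteq> words X"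
  shows "group (presented_group X R)"
proof (rule groupI)
  let ?G = "presented_group X R"
  note [simp] = presented_group_mult[OF R]
  have carrier: "carrier ?G = word_class X R ` words X" and one: "\<one>\<^bsub>?G\<^esub> = word_class X R []"
    by (simp_all add: presented_group_def)
  show "\<one>\<^bsub>?G\<^esub> \<in> carrier ?G" by (simp add: carrier one)
  show "x \<otimes>\<^bsub>?G\<^esub> y \<in> carrier ?G" if "x \<in> carrier ?G" "y \<in> carrier ?G" for x y
    using that by (auto simp: carrier)
  show "x \<otimes>\<^bsub>?G\<^esub> y \<otimes>\<^bsub>?G\<^esub> z = x \<otimes>\<^bsub>?G\<^esub> (y \<otimes>\<^bsub>?G\<^esub> z)"
    if "x \<in> carrier ?G" "y \<in> carrier ?G" "z \<in> carrier ?G" for x y z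
    using that by (auto simp: carrier)
  show "\<one>\<^bsub>?G\<^esub> \<otimes>\<^bsub>?G\<^esub> x = x" if "x \<in> carrier ?G" for x
    using that by (auto simp: carrier one)
  show "\<exists>y\<in>carrier ?G. y \<otimes>\<^bsub>?G\<^esub> x = \<one>\<^bsub>?G\<^esub>" if "x \<in> carrier ?G" for x
  proof -
    from that obtain w where w: "w \<in> words X" "x = word_class X R w" by (auto simp: carrier)
    then have "word_class X R (word_inv w) \<otimes>\<^bsub>?G\<^esub> x = \<one>\<^bsub>?G\<^esub>"
      by (simp add: one word_class_eq_iff pres_eq_word_inv)
    then show ?thesis using w by (auto simp: carrier)
  qed
qed


section \<open>Amalgamated products of finite groups\<close>

text \<open>The relation \<open>\<phi>\<^sub>1(a) = \<phi>\<^sub>2(a)\<close> is an equation between words: \<open>w\<^sub>i\<close> picks a word over \<open>X\<^sub>i\<close>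
  representing \<open>\<phi>\<^sub>i(a)\<close>. (The elements of a presented group are classes of words, so
  \<open>w\<^sub>i a \<in> \<phi>\<^sub>i a\<close> says exactly this.)\<close>

locale finite_group_amalgam =
  fixes X1 X2 :: "'x set"
    and R1 R2 :: "'x word set"
    and A :: "('a, 'm) monoid_scheme"
    and Y :: "'a set"
    and \<phi>1 \<phi>2 :: "'a \<Rightarrow> 'x word set"
    and w1 w2 :: "'a \<Rightarrow> 'x word"
  assumes finite_generators: "finite X1" "finite X2"
    and finite_relators: "finite R1" "finite R2"
    and relators: "R1 \<subseteq> words X1" "R2 \<subseteq> words X2"
    and disjoint: "letters X1 \<inter> letters X2 = {}"
    and finite_groups:
      "finite (carrier (presented_group X1 R1))" "finite (carrier (presented_group X2 R2))"
    and group_A: "group A"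
    and generators_A: "Y \<subseteq> carrier A" "generate A Y = carrier A"
    and mono: "\<phi>1 \<in> mon A (presented_group X1 R1)" "\<phi>2 \<in> mon A (presented_group X2 R2)"
    and representatives: "\<And>a. a \<in> Y \<Longrightarrow> w1 a \<in> \<phi>1 a" "\<And>a. a \<in> Y \<Longrightarrow> w2 a \<in> \<phi>2 a"

definition amalgam_relators ::
  "'x word set \<Rightarrow> 'x word set \<Rightarrow> 'a set \<Rightarrow> ('a \<Rightarrow> 'x word) \<Rightarrow> ('a \<Rightarrow> 'x word) \<Rightarrow> 'x word set" where
  "amalgam_relators R1 R2 Y w1 w2 = R1 \<union> R2 \<union> {w1 a @ word_inv (w2 a) | a. a \<in> Y}"


section \<open>Algorithms\<close>

text \<open>Kleene's partial recursive functions; programs are applied to lists of natural numbers.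
  In \<open>PrimRec f g\<close> the recursion is on the first argument, and \<open>g\<close> receives the predecessor, the
  previous value and the parameters. \<open>Mu f\<close> searches for the least first argument on which \<open>f\<close>
  vanishes, \<open>f\<close> being defined on all smaller ones.\<close>

datatype recf =
    Zero
  | Succ
  | Proj nat
  | Comp recf "recf list"
  | PrimRec recf recf
  | Mu recf

inductive rec_eval :: "recf \<Rightarrow> nat list \<Rightarrow> nat \<Rightarrow> bool" where
  Zero: "rec_eval Zero xs 0"
| Succ: "rec_eval Succ [x] (Suc x)"
| Proj: "i < length xs \<Longrightarrow> rec_eval (Proj i) xs (xs ! i)"
| Comp: "list_all2 (\<lambda>g y. rec_eval g xs y) gs ys \<Longrightarrow> rec_eval f ys z \<Longrightarrow>
    rec_eval (Comp f gs) xs z"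
| PrimRec_0: "rec_eval f xs y \<Longrightarrow> rec_eval (PrimRec f g) (0 # xs) y"
| PrimRec_Suc: "rec_eval (PrimRec f g) (n # xs) y \<Longrightarrow> rec_eval g (n # y # xs) z \<Longrightarrow>
    rec_eval (PrimRec f g) (Suc n # xs) z"
| Mu: "rec_eval f (n # xs) 0 \<Longrightarrow> (\<And>m. m < n \<Longrightarrow> \<exists>y. rec_eval f (m # xs) (Suc y)) \<Longrightarrow>
    rec_eval (Mu f) xs n"

lemma rec_eval_deterministic:
  assumes "rec_eval f xs y" "rec_eval f xs z"
  shows "y = z"
  using assms
proof (induction arbitrary: z rule: rec_eval.induct)
  case (Comp xs gs ys f y)
  from Comp.prems obtain ys' where ys': "list_all2 (\<lambda>g y. rec_eval g xs y) gs ys'" "rec_eval f ys' z"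
    by cases
  have "ys = ys'"
    using Comp.IH(1) ys'(1) by (auto simp: list_all2_conv_all_nth list_eq_iff_nth_eq)
  then show ?case using Comp.IH(2) ys'(2) by simp
next
  case (PrimRec_0 f xs y g)
  from PrimRec_0.prems show ?case by cases (use PrimRec_0.IH in auto)
next
  case (PrimRec_Suc f g n xs y z')
  from PrimRec_Suc.prems show ?case by cases (use PrimRec_Suc.IH in blast)
next
  case (Mu f n xs)
  from Mu.prems have z: "rec_eval f (z # xs) 0" "\<And>m. m < z \<Longrightarrow> \<exists>y. rec_eval f (m # xs) (Suc y)"
    by (cases, blast)+
  show ?case
  proof (rule linorder_cases[of n z])
    assume "n < z"
    then obtain y where "rec_eval f (n # xs) (Suc y)" using z(2) by blast
    then show ?thesis using Mu.IH(1) by blast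
  next
    assume "z < n"
    then show ?thesis using Mu.IH(2) z(1) by blast
  qed
qed (auto elim: rec_eval.cases)

text \<open>Words are presented to a program through a numbering of the letters and \<^const>\<open>list_encode\<close>.
  Since the alphabet is finite, the choice of the numbering is immaterial.\<close>

definition word_code :: "('x letter \<Rightarrow> nat) \<Rightarrow> 'x word \<Rightarrow> nat" where
  "word_code num w = list_encode (map num w)"

definition decides ::
  "recf \<Rightarrow> ('x letter \<Rightarrow> nat) \<Rightarrow> 'x word set \<Rightarrow> ('x word \<Rightarrow> 'x word \<Rightarrow> bool) \<Rightarrow> bool" where
  "decides p num W P \<longleftrightarrow>
    (\<forall>u\<in>W. \<forall>v\<in>W. rec_eval p [word_code num u, word_code num v] (if P u v then 1 else 0))"

end

theory Submission
  imports Defs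
begin

text \<open>
  Let \<open>G\<close> be the amalgamated product of the finite groups \<open>H False\<close> and \<open>H True\<close> over \<open>A\<close>. Conjugacy in
  \<open>G\<close> is decided by searching for a conjugator: \<open>k\<close> and \<open>h\<close> are conjugate if and only if \<open>g k = h g\<close> for
  some word \<open>g\<close> of length below a computable bound. This needs a solution of the word problem, a
  bound on conjugators, and a translation of both into recursive functions.

  \<^emph>\<open>Word problem.\<close> Choose representatives of the left cosets of \<open>A\<close> in each factor. Every element
  of \<open>G\<close> is a product \<open>t\<^sub>1 \<cdots> t\<^sub>n a\<close> of representatives \<open>t\<^sub>i \<noteq> 1\<close> taken alternately from the two
  factors, with \<open>a\<close> in \<open>A\<close>. Following van der Waerden, let each factor act from the right on these
  sequences, viewed as a stack whose top is next to the component \<open>a\<close>; only \<open>a\<close> and the top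
  change. Since both factor actions restrict to the same action of \<open>A\<close>, they respect the relators of \<open>G\<close>
  (\<open>act_pres_eq\<close>), so the stack reached from the empty one by reading a word depends only on the element
  of \<open>G\<close>. Conversely the stack determines the element (\<open>val_normal\<close>).

  \<^emph>\<open>Bound.\<close> Let the length of an element be its number of representatives, and consider \<open>g k g\<^sup>-\<^sup>1\<close> with
  \<open>g = s\<^sub>m \<cdots> s\<^sub>1\<close> reduced. Conjugate \<open>k\<close> successively by \<open>s\<^sub>1\<close>, \<open>s\<^sub>2\<close> and so on. If one of these steps makes the
  element longer, then the result begins and ends in the factor of that step
  (\<open>conjugate_longer_between\<close>); the next syllable lies in the other factor, so nothing cancels from
  then on and the length never falls again (\<open>len_conjugate_between\<close>). Hence all intermediate elements are at
  most as long as the longer one of \<open>k\<close> and \<open>h = g k g\<^sup>-\<^sup>1\<close> (\<open>conjugate_chain\<close>). This is the convexity of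
  the displacement function on the Bass-Serre tree. There are only finitely many elements of bounded
  length, because \<open>A\<close> and the factors are finite, so a shortest path of such conjugation steps has
  bounded length, which gives a conjugator of bounded length (\<open>conjugate_bounded\<close>).

  \<^emph>\<open>Recursive functions.\<close> A state of the stack is coded by a list of numbers, of which reading a letter
  changes only the first two; this is a finite table. Folding the table over a word, and searching
  for \<open>g\<close> below the bound, stay within the recursive functions (\<open>recursive_rewrite_prefix\<close>,
  \<open>recursive_foldl\<close>, \<open>recursive_bounded_ex_eq\<close>).
\<close>

section \<open>Total recursive functions\<close>

text \<open>Only total functions are considered, and only their values on argument lists of length \<open>n\<close>
  matter: outside these, a program is free to do anything.\<close>

definition recursive :: "nat \<Rightarrow> (nat list \<Rightarrow> nat) \<Rightarrow> bool" where
  "recursive n f \<longleftrightarrow> (\<exists>p. \<forall>xs. length xs = n \<longrightarrow> rec_eval p xs (f xs))"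

named_theorems rec_intros

lemma recursive_cong:
  assumes "recursive n f" "\<And>xs. length xs = n \<Longrightarrow> f xs = g xs"
  shows "recursive n g"
  using assms unfolding recursive_def by metis

lemma recursive_proj [rec_intros]: "i < n \<Longrightarrow> recursive n (\<lambda>xs. xs ! i)"
  unfolding recursive_def by (metis rec_eval.Proj)

lemma recursive_compose:
  assumes "recursive (length gs) f" "\<And>g. g \<in> set gs \<Longrightarrow> recursive n g"
  shows "recursive n (\<lambda>xs. f (map (\<lambda>g. g xs) gs))"
proof -
  obtain p where p: "\<And>xs. length xs = length gs \<Longrightarrow> rec_eval p xs (f xs)"
    using assms(1) unfolding recursive_def by blast
  obtain q where q: "\<And>g xs. g \<in> set gs \<Longrightarrow> length xs = n \<Longrightarrow> rec_eval (q g) xs (g xs)"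
    using assms(2) unfolding recursive_def by metis
  have "rec_eval (Comp p (map q gs)) xs (f (map (\<lambda>g. g xs) gs))" if "length xs = n" for xs
    by (rule rec_eval.Comp[where ys = "map (\<lambda>g. g xs) gs"])
      (use that p q in \<open>auto simp: list_all2_conv_all_nth\<close>)
  then show ?thesis unfolding recursive_def by blast
qed

lemma recursive_compose1:
  assumes "recursive 1 (\<lambda>ys. F (ys ! 0))" "recursive n f"
  shows "recursive n (\<lambda>xs. F (f xs))"
  using recursive_compose[of "[f]" "\<lambda>ys. F (ys ! 0)" n] assms by simp

lemma recursive_compose2:
  assumes "recursive 2 (\<lambda>ys. F (ys ! 0) (ys ! 1))" "recursive n f" "recursive n g"
  shows "recursive n (\<lambda>xs. F (f xs) (g xs))"
  using recursive_compose[of "[f, g]" "\<lambda>ys. F (ys ! 0) (ys ! 1)" n] assms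
  by (auto simp: numeral_2_eq_2)

lemma recursive_Suc [rec_intros]:
  assumes "recursive n f"
  shows "recursive n (\<lambda>xs. Suc (f xs))"
proof (rule recursive_compose1[OF _ assms])
  have "rec_eval Succ xs (Suc (xs ! 0))" if "length xs = 1" for xs
    using that rec_eval.Succ by (cases xs) auto
  then show "recursive 1 (\<lambda>ys. Suc (ys ! 0))" unfolding recursive_def by blast
qed

lemma recursive_const [rec_intros]: "recursive n (\<lambda>_. c)"
proof (induction c)
  case 0
  show ?case unfolding recursive_def using rec_eval.Zero by blast
next
  case (Suc c)
  then show ?case by (rule recursive_Suc)
qed

text \<open>A \<open>PrimRec\<close> program recurses on its first argument. Here the number of rounds may be any
  recursive function of the parameters, so that the rule applies to a goal without first separating a
  recursion argument. The step sees the counter, the previous value, and then the parameters.\<close>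

lemma recursive_rec_nat:
  assumes c: "recursive n c" and f: "recursive n f"
    and g: "recursive (Suc (Suc n)) (\<lambda>ys. g (ys ! 0) (ys ! 1) (tl (tl ys)))"
  shows "recursive n (\<lambda>xs. rec_nat (f xs) (\<lambda>k y. g k y xs) (c xs))"
proof -
  obtain p where p: "\<And>xs. length xs = n \<Longrightarrow> rec_eval p xs (f xs)"
    using f unfolding recursive_def by blast
  obtain q where q: "\<And>ys. length ys = Suc (Suc n) \<Longrightarrow> rec_eval q ys (g (ys ! 0) (ys ! 1) (tl (tl ys)))"
    using g unfolding recursive_def by blast
  have main: "rec_eval (PrimRec p q) (k # xs) (rec_nat (f xs) (\<lambda>k y. g k y xs) k)"
    if "length xs = n" for k xs
  proof (induction k)
    case 0
    then show ?case using p that by (auto intro: rec_eval.PrimRec_0)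
  next
    case (Suc k)
    show ?case using rec_eval.PrimRec_Suc[OF Suc q] that by simp
  qed
  define h where "h = (\<lambda>ys. rec_nat (f (tl ys)) (\<lambda>k y. g k y (tl ys)) (hd ys))"
  have h: "recursive (Suc n) h"
    unfolding recursive_def h_def
    by (rule exI[of _ "PrimRec p q"]) (use main in \<open>auto simp: length_Suc_conv\<close>)
  define gs where "gs = c # map (\<lambda>i xs. xs ! i) [0..<n]"
  have "recursive n (\<lambda>xs. h (map (\<lambda>g. g xs) gs))"
    by (rule recursive_compose) (use h c in \<open>auto simp: gs_def intro: recursive_proj\<close>)
  then show ?thesis
    by (rule recursive_cong) (simp add: gs_def h_def comp_def, use map_nth in metis)
qed

lemma recursive_tl_tl_nth [rec_intros]: "Suc (Suc i) < n \<Longrightarrow> recursive n (\<lambda>xs. tl (tl xs) ! i)"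
  by (rule recursive_cong[OF recursive_proj[of "Suc (Suc i)"]]) (auto simp: nth_tl)

lemma recursive_funpow:
  assumes "recursive n c" "recursive n f"
    and "recursive (Suc (Suc n)) (\<lambda>ys. g (ys ! 1) (tl (tl ys)))"
  shows "recursive n (\<lambda>xs. ((\<lambda>y. g y xs) ^^ c xs) (f xs))"
proof -
  have "((\<lambda>y. g y xs) ^^ k) z = rec_nat z (\<lambda>k y. g y xs) k" for xs k z
    by (induction k) auto
  then show ?thesis using recursive_rec_nat[OF assms(1,2), of "\<lambda>k. g"] assms(3) by simp
qed

lemma recursive_add [rec_intros]:
  assumes "recursive n f" "recursive n g"
  shows "recursive n (\<lambda>xs. f xs + g xs)"
proof (rule recursive_compose2[OF _ assms])
  have "recursive 2 (\<lambda>ys. (Suc ^^ (ys ! 0)) (ys ! 1))"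
    by (rule recursive_funpow) (intro rec_intros; simp)+
  then show "recursive 2 (\<lambda>ys. ys ! 0 + ys ! 1)" by simp
qed

lemma recursive_mult [rec_intros]:
  assumes "recursive n f" "recursive n g"
  shows "recursive n (\<lambda>xs. f xs * g xs)"
proof (rule recursive_compose2[OF _ assms])
  have "recursive 2 (\<lambda>ys. ((\<lambda>y. y + ys ! 1) ^^ (ys ! 0)) 0)"
    by (rule recursive_funpow) (intro rec_intros; simp)+
  moreover have "((\<lambda>y. y + b) ^^ a) 0 = a * b" for a b :: nat
    by (induction a) auto
  ultimately show "recursive 2 (\<lambda>ys. ys ! 0 * ys ! 1)" by simp
qed

lemma recursive_diff [rec_intros]:
  assumes "recursive n f" "recursive n g"
  shows "recursive n (\<lambda>xs. f xs - g xs)"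
proof (rule recursive_compose2[OF _ assms])
  have "recursive 1 (\<lambda>ys. rec_nat 0 (\<lambda>k y. k) (ys ! 0))"
    by (rule recursive_rec_nat) (intro rec_intros; simp)+
  moreover have "rec_nat 0 (\<lambda>k y. k) a = a - 1" for a :: nat
    by (cases a) auto
  ultimately have pred: "recursive 1 (\<lambda>ys. ys ! 0 - 1)" by simp
  have "recursive 2 (\<lambda>ys. ((\<lambda>y. y - 1) ^^ (ys ! 1)) (ys ! 0))"
    by (rule recursive_funpow) (intro rec_intros recursive_compose1[OF pred]; simp)+
  moreover have "((\<lambda>y. y - 1) ^^ b) a = a - b" for a b :: nat
    by (induction b) auto
  ultimately show "recursive 2 (\<lambda>ys. ys ! 0 - ys ! 1)" by simp
qed

lemma recursive_if_eq [rec_intros]: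
  assumes "recursive n f" "recursive n g" "recursive n a" "recursive n b"
  shows "recursive n (\<lambda>xs. if f xs = g xs then a xs else b xs)"
proof -
  \<comment> \<open>\<open>d x y\<close> is \<open>1\<close> if \<open>x = y\<close> and \<open>0\<close> otherwise.\<close>
  define d where "d x y = (1 - ((x - y) + (y - x)))" for x y :: nat
  have "recursive n (\<lambda>xs. d (f xs) (g xs) * a xs + (1 - d (f xs) (g xs)) * b xs)"
    unfolding d_def using assms by (intro rec_intros)
  then show ?thesis by (rule recursive_cong) (auto simp: d_def)
qed

lemma recursive_triangle: "recursive 1 (\<lambda>ys. triangle (ys ! 0))"
proof -
  have "recursive 1 (\<lambda>ys. rec_nat 0 (\<lambda>k y. y + Suc k) (ys ! 0))"
    by (rule recursive_rec_nat) (intro rec_intros; simp)+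
  moreover have "rec_nat 0 (\<lambda>k y. y + Suc k) a = triangle a" for a
    by (induction a) auto
  ultimately show ?thesis by simp
qed

lemma recursive_prod_encode [rec_intros]:
  assumes "recursive n f" "recursive n g"
  shows "recursive n (\<lambda>xs. prod_encode (f xs, g xs))"
  unfolding prod_encode_def using assms
  by (simp, intro rec_intros recursive_compose1[OF recursive_triangle])


text \<open>The pair with code \<open>n\<close> lies on the diagonal given by the number of the last triangular number up to
  \<open>n\<close>. Computing this number by primitive recursion makes both projections recursive.\<close>

definition diagonal :: "nat \<Rightarrow> nat" where
  "diagonal = rec_nat 0 (\<lambda>k y. if Suc k = triangle (Suc y) then Suc y else y)"

lemma diagonal_bounds: "triangle (diagonal n) \<le> n \<and> n < triangle (Suc (diagonal n))"
  by (induction n) (auto simp: diagonal_def)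

lemma diagonal_prod_encode: "diagonal (prod_encode (a, b)) = a + b"
proof -
  have mono: "mono triangle" by (simp add: mono_iff_le_Suc)
  define d where "d = diagonal (prod_encode (a, b))"
  have d: "triangle d \<le> triangle (a + b) + a" "triangle (a + b) + a < triangle (Suc d)"
    using diagonal_bounds[of "prod_encode (a, b)"] by (auto simp: d_def prod_encode_def)
  have "\<not> Suc (a + b) \<le> d" "\<not> Suc d \<le> a + b"
    using monoD[OF mono, of "Suc (a + b)" d] monoD[OF mono, of "Suc d" "a + b"] d by auto
  then show ?thesis by (simp add: d_def)
qed

lemma prod_decode_diagonal:
  "fst (prod_decode n) = n - triangle (diagonal n)"
  "snd (prod_decode n) = diagonal n - fst (prod_decode n)"
proof -
  obtain a b where n: "n = prod_encode (a, b)" by (metis prod_decode_inverse surj_pair)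
  show "fst (prod_decode n) = n - triangle (diagonal n)"
    unfolding n diagonal_prod_encode prod_encode_inverse by (simp add: prod_encode_def)
  show "snd (prod_decode n) = diagonal n - fst (prod_decode n)"
    unfolding n diagonal_prod_encode prod_encode_inverse by simp
qed

lemma recursive_prod_decode [rec_intros]:
  assumes "recursive n f"
  shows "recursive n (\<lambda>xs. fst (prod_decode (f xs)))" "recursive n (\<lambda>xs. snd (prod_decode (f xs)))"
proof -
  have d: "recursive 1 (\<lambda>ys. diagonal (ys ! 0))"
    unfolding diagonal_def
    by (rule recursive_rec_nat) (intro rec_intros recursive_compose1[OF recursive_triangle]; simp)+
  show fst: "recursive n (\<lambda>xs. fst (prod_decode (f xs)))"
    unfolding prod_decode_diagonal
    by (intro rec_intros recursive_compose1[OF recursive_triangle] recursive_compose1[OF d] assms)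
  show "recursive n (\<lambda>xs. snd (prod_decode (f xs)))"
    unfolding prod_decode_diagonal(2)
    by (intro rec_intros recursive_compose1[OF d] assms fst)
qed

definition head_code :: "nat \<Rightarrow> nat" where
  "head_code c = fst (prod_decode (c - 1))"

definition tail_code :: "nat \<Rightarrow> nat" where
  "tail_code c = snd (prod_decode (c - 1))"

lemma head_tail_code [simp]:
  "head_code (Suc (prod_encode (a, b))) = a" "tail_code (Suc (prod_encode (a, b))) = b"
  by (simp_all add: head_code_def tail_code_def)

lemma recursive_head_tail [rec_intros]:
  assumes "recursive n f"
  shows "recursive n (\<lambda>xs. head_code (f xs))" "recursive n (\<lambda>xs. tail_code (f xs))"
  unfolding head_code_def tail_code_def by (intro rec_intros assms)+

lemma length_le_list_encode: "length xs \<le> list_encode xs"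
  by (induction xs) (auto intro: order.trans[OF _ le_prod_encode_2])

text \<open>The loop iterates on the pair of the accumulator and the rest of the list. The code of the list
  serves as the number of rounds: it is at least the length, and the superfluous rounds change nothing.\<close>

lemma recursive_foldl:
  assumes S: "recursive 2 (\<lambda>ys. S (ys ! 0) (ys ! 1))" and f: "recursive n f" and g: "recursive n g"
  shows "recursive n (\<lambda>xs. foldl S (f xs) (list_decode (g xs)))"
proof -
  define step where "step y = (let s = fst (prod_decode y); c = snd (prod_decode y) in
    if c = 0 then y else prod_encode (S s (head_code c), tail_code c))" for y
  have "recursive n (\<lambda>xs. (step ^^ g xs) (prod_encode (f xs, g xs)))"
    by (rule recursive_funpow)
      (use f g in \<open>simp_all add: step_def Let_def rec_intros recursive_compose2[OF S]\<close>)
  moreover have steps: "(step ^^ k) (prod_encode (s, list_encode ns)) =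
      prod_encode (foldl S s (take k ns), list_encode (drop k ns))" for k s ns
  proof (induction k arbitrary: s ns)
    case (Suc k)
    have "step (prod_encode (s, list_encode ns)) =
        prod_encode (foldl S s (take 1 ns), list_encode (drop 1 ns))"
      by (cases ns) (auto simp: step_def)
    then show ?case
      using Suc[of "foldl S s (take 1 ns)" "drop 1 ns"]
      by (cases ns) (simp_all add: funpow_Suc_right del: funpow.simps)
  qed auto
  have "(step ^^ c) (prod_encode (s, c)) = prod_encode (foldl S s (list_decode c), 0)" for s c
    using steps[of c s "list_decode c"] length_le_list_encode[of "list_decode c"] by simp
  ultimately have "recursive n (\<lambda>xs. prod_encode (foldl S (f xs) (list_decode (g xs)), 0))" by simp
  from recursive_prod_decode(1)[OF this] show ?thesis by simp
qed

lemma recursive_bounded_ex_eq: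
  assumes "recursive n b"
    and "recursive (Suc (Suc n)) (\<lambda>ys. F (ys ! 0) (tl (tl ys)))"
    and "recursive (Suc (Suc n)) (\<lambda>ys. G (ys ! 0) (tl (tl ys)))"
  shows "recursive n (\<lambda>xs. if \<exists>c\<le>b xs. F c xs = G c xs then 1 else 0)"
proof -
  have "recursive n (\<lambda>xs. rec_nat 0 (\<lambda>k y. if F k xs = G k xs then 1 else y) (Suc (b xs)))"
    by (rule recursive_rec_nat) (use assms in \<open>simp_all add: rec_intros\<close>)
  moreover have "rec_nat 0 (\<lambda>k y. if F k xs = G k xs then 1 else y) m =
      (if \<exists>c<m. F c xs = G c xs then 1 else 0 :: nat)" for xs and m :: nat
    by (induction m) (auto simp: less_Suc_eq)
  ultimately show ?thesis by (simp only: less_Suc_eq_le)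
qed

text \<open>A function that vanishes almost everywhere is a nested case distinction over its finitely many
  other arguments, however it is defined. This is what allows the multiplication tables of finite groups,
  coset representatives and so on to be built into a program.\<close>

lemma recursive_finite_support:
  assumes "finite {x. F x \<noteq> 0}" "recursive n f"
  shows "recursive n (\<lambda>xs. F (f xs))"
proof -
  have "recursive n (\<lambda>xs. if f xs \<in> D then F (f xs) else 0)" if "finite D" for D
    using that
  proof (induction D)
    case (insert d D)
    have "recursive n (\<lambda>xs. if f xs = d then F d else if f xs \<in> D then F (f xs) else 0)"
      by (intro rec_intros assms(2) insert.IH)
    then show ?case by (rule recursive_cong) auto
  qed (simp add: rec_intros)
  from this[OF assms(1)] show ?thesis by (rule recursive_cong) auto
qed

lemma prod_encode_mono: "a \<le> a' \<Longrightarrow> b \<le> b' \<Longrightarrow> prod_encode (a, b) \<le> prod_encode (a', b')"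
  using mono_iff_le_Suc[of triangle] monoD[of triangle "a + b" "a' + b'"]
  by (simp add: prod_encode_def)

text \<open>The code of the list consisting of \<open>n\<close> copies of \<open>K\<close>, which is the largest code among the lists
  with at most \<open>n\<close> entries, all at most \<open>K\<close>.\<close>

definition code_bound :: "nat \<Rightarrow> nat \<Rightarrow> nat" where
  "code_bound K n = ((\<lambda>y. Suc (prod_encode (K, y))) ^^ n) 0"

lemma list_encode_le_code_bound:
  "set ns \<subseteq> {..K} \<Longrightarrow> length ns \<le> n \<Longrightarrow> list_encode ns \<le> code_bound K n"
proof (induction ns arbitrary: n)
  case (Cons x ns)
  then obtain m where m: "n = Suc m" "length ns \<le> m" by (cases n) auto
  then show ?case using Cons by (simp add: code_bound_def prod_encode_mono)
qed simp

lemma recursive_code_bound [rec_intros]: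
  assumes "recursive n f"
  shows "recursive n (\<lambda>xs. code_bound K (f xs))"
  unfolding code_bound_def
  by (rule recursive_funpow[OF assms]) (intro rec_intros; simp)+

lemma tail_code_0 [simp]: "tail_code 0 = 0"
  using prod_encode_inverse[of "(0, 0)"] by (simp add: tail_code_def prod_encode_def)

text \<open>A pushdown step replaces the first two entries of a list by others that depend on them and
  on an input symbol. If only finitely many configurations are changed, then the replacements form a finite
  table. The table stores the replacement in reverse, so that a fold can push it onto the rest, and stores
  \<open>0\<close> for a configuration that stays as it is.\<close>

lemma recursive_rewrite_prefix:
  fixes \<delta> :: "nat list \<Rightarrow> nat \<Rightarrow> nat list"
  assumes fin: "finite {(w, x). \<delta> w x \<noteq> w}"
  shows "recursive 2 (\<lambda>ys. list_encode
    (\<delta> (take 2 (list_decode (ys ! 0))) (ys ! 1) @ drop 2 (list_decode (ys ! 0))))"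
proof -
  define F where "F n = (let w = list_decode (fst (prod_decode n)); x = snd (prod_decode n) in
    if \<delta> w x = w then 0 else Suc (list_encode (rev (\<delta> w x))))" for n
  define prefix where "prefix c = (if c = 0 then 0 else Suc (prod_encode (head_code c,
    if tail_code c = 0 then 0 else Suc (prod_encode (head_code (tail_code c), 0)))))" for c
  define push where "push c x = Suc (prod_encode (x, c))" for c x
  define step where "step c x = (if F (prod_encode (prefix c, x)) = 0 then c
    else foldl push (tail_code (tail_code c)) (list_decode (F (prod_encode (prefix c, x)) - 1)))" for c x
  have "{n. F n \<noteq> 0} \<subseteq> (\<lambda>(w, x). prod_encode (list_encode w, x)) ` {(w, x). \<delta> w x \<noteq> w}"
  proof
    fix n assume "n \<in> {n. F n \<noteq> 0}"
    then show "n \<in> (\<lambda>(w, x). prod_encode (list_encode w, x)) ` {(w, x). \<delta> w x \<noteq> w}"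
      by (intro image_eqI[of _ _ "(list_decode (fst (prod_decode n)), snd (prod_decode n))"])
        (auto simp: F_def Let_def split: if_splits)
  qed
  then have "finite {n. F n \<noteq> 0}" using finite_imageI[OF fin] by (rule finite_subset)
  then have F: "recursive n f \<Longrightarrow> recursive n (\<lambda>xs. F (f xs))" for n f
    by (rule recursive_finite_support)
  have push: "recursive 2 (\<lambda>ys. push (ys ! 0) (ys ! 1))"
    unfolding push_def by (intro rec_intros; simp)
  have "recursive 2 (\<lambda>ys. step (ys ! 0) (ys ! 1))"
    unfolding step_def prefix_def by (intro rec_intros recursive_foldl[OF push] F; simp)
  moreover have "step c x = list_encode (\<delta> (take 2 (list_decode c)) x @ drop 2 (list_decode c))" for c x
  proof -
    obtain w where c: "c = list_encode w" by (metis list_decode_inverse)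
    have prefix: "prefix c = list_encode (take 2 w)"
      unfolding c prefix_def by (cases w rule: remdups_adj.cases) auto
    have tl: "tail_code (tail_code c) = list_encode (drop 2 w)"
      unfolding c by (cases w rule: remdups_adj.cases) auto
    have push: "foldl push (list_encode v) (rev u) = list_encode (u @ v)" for u v
      by (induction u) (auto simp: push_def)
    have "step c x = list_encode (\<delta> (take 2 w) x @ drop 2 w)"
      by (simp add: step_def prefix tl F_def push Let_def) (simp add: c)
    then show ?thesis by (simp add: c)
  qed
  ultimately show ?thesis by simp
qed

section \<open>Normal forms in an amalgamated product\<close>

text \<open>The two factors are indexed by \<open>bool\<close>, so that statements about one factor and the other one, \<open>\<not> b\<close>,
  need not be duplicated.\<close>

locale amalgam =
  fixes H :: "bool \<Rightarrow> ('g, 'h) monoid_scheme"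
    and A :: "('a, 'm) monoid_scheme"
    and \<phi> :: "bool \<Rightarrow> 'a \<Rightarrow> 'g"
  assumes group_H: "\<And>b. group (H b)"
    and group_A: "group A"
    and mono: "\<And>b. \<phi> b \<in> mon A (H b)"
begin

sublocale H: group "H b" for b by (rule group_H)
sublocale A: group A by (rule group_A)
sublocale \<phi>: group_hom A "H b" "\<phi> b" for b
  using mono by unfold_locales (auto simp: mon_def)

lemma \<phi>_eq_iff [simp]: "a \<in> carrier A \<Longrightarrow> a' \<in> carrier A \<Longrightarrow> \<phi> b a = \<phi> b a' \<longleftrightarrow> a = a'"
  using mono[of b] by (auto simp: mon_def dest: inj_onD)

definition amal :: "bool \<Rightarrow> 'g set" where
  "amal b = \<phi> b ` carrier A"

lemma subgroup_amal: "subgroup (amal b) (H b)"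
  unfolding amal_def by (rule \<phi>.img_is_subgroup)

lemma amal_carrier [simp]: "g \<in> amal b \<Longrightarrow> g \<in> carrier (H b)"
  using subgroup.mem_carrier[OF subgroup_amal] .

lemma \<phi>_amal [simp]: "a \<in> carrier A \<Longrightarrow> \<phi> b a \<in> amal b"
  by (simp add: amal_def)

lemma one_amal [simp]: "\<one>\<^bsub>H b\<^esub> \<in> amal b"
  using subgroup.one_closed[OF subgroup_amal] .

lemma mult_amal_left [simp]:
  assumes "x \<in> amal b" "g \<in> carrier (H b)"
  shows "x \<otimes>\<^bsub>H b\<^esub> g \<in> amal b \<longleftrightarrow> g \<in> amal b"
proof
  assume "x \<otimes>\<^bsub>H b\<^esub> g \<in> amal b"
  then have "inv\<^bsub>H b\<^esub> x \<otimes>\<^bsub>H b\<^esub> (x \<otimes>\<^bsub>H b\<^esub> g) \<in> amal b"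
    using assms subgroup.m_closed[OF subgroup_amal] subgroup.m_inv_closed[OF subgroup_amal] by blast
  then show "g \<in> amal b" using assms by (simp flip: H.m_assoc)
qed (use assms subgroup.m_closed[OF subgroup_amal] in blast)

lemma mult_amal_right [simp]:
  assumes "x \<in> amal b" "g \<in> carrier (H b)"
  shows "g \<otimes>\<^bsub>H b\<^esub> x \<in> amal b \<longleftrightarrow> g \<in> amal b"
proof
  assume "g \<otimes>\<^bsub>H b\<^esub> x \<in> amal b"
  then have "(g \<otimes>\<^bsub>H b\<^esub> x) \<otimes>\<^bsub>H b\<^esub> inv\<^bsub>H b\<^esub> x \<in> amal b"
    using assms subgroup.m_closed[OF subgroup_amal] subgroup.m_inv_closed[OF subgroup_amal] by blast
  then show "g \<in> amal b" using assms by (simp add: H.m_assoc)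
qed (use assms subgroup.m_closed[OF subgroup_amal] in blast)

lemma inv_amal [simp]: "g \<in> carrier (H b) \<Longrightarrow> inv\<^bsub>H b\<^esub> g \<in> amal b \<longleftrightarrow> g \<in> amal b"
  using subgroup.m_inv_closed[OF subgroup_amal] by (metis H.inv_inv)

text \<open>The representative of a left coset of the amalgamated subgroup, and the element of \<open>A\<close> by which
  \<open>g\<close> differs from it. The choice depends only on the coset, as \<open>rep_mult_\<phi>\<close> below shows, and the subgroup
  itself is represented by the identity; this case marks the syllables that vanish from a normal form.\<close>

definition rep :: "bool \<Rightarrow> 'g \<Rightarrow> 'g" where
  "rep b g = (if g \<in> amal b then \<one>\<^bsub>H b\<^esub> else SOME t. \<exists>a\<in>carrier A. t = g \<otimes>\<^bsub>H b\<^esub> \<phi> b a)"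

definition amal_part :: "bool \<Rightarrow> 'g \<Rightarrow> 'a" where
  "amal_part b g = inv_into (carrier A) (\<phi> b) (inv\<^bsub>H b\<^esub> (rep b g) \<otimes>\<^bsub>H b\<^esub> g)"

lemma rep_coset:
  assumes "g \<in> carrier (H b)"
  shows "\<exists>a\<in>carrier A. rep b g = g \<otimes>\<^bsub>H b\<^esub> \<phi> b a"
proof (cases "g \<in> amal b")
  case True
  then obtain a where "a \<in> carrier A" "g = \<phi> b a" by (auto simp: amal_def)
  then show ?thesis using True by (intro bexI[of _ "inv\<^bsub>A\<^esub> a"]) (auto simp: rep_def)
next
  case False
  have "\<exists>t. \<exists>a\<in>carrier A. t = g \<otimes>\<^bsub>H b\<^esub> \<phi> b a" by blast
  from someI_ex[OF this] show ?thesis using False by (simp add: rep_def)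
qed

lemma rep_closed [simp]: "g \<in> carrier (H b) \<Longrightarrow> rep b g \<in> carrier (H b)"
  using rep_coset[of g b] by auto

lemma rep_amal [simp]: "g \<in> carrier (H b) \<Longrightarrow> rep b g \<in> amal b \<longleftrightarrow> g \<in> amal b"
  using rep_coset[of g b] by auto

lemma rep_mult_\<phi> [simp]:
  assumes "g \<in> carrier (H b)" "a \<in> carrier A"
  shows "rep b (g \<otimes>\<^bsub>H b\<^esub> \<phi> b a) = rep b g"
proof -
  have "(\<exists>c\<in>carrier A. t = g \<otimes>\<^bsub>H b\<^esub> \<phi> b a \<otimes>\<^bsub>H b\<^esub> \<phi> b c) \<longleftrightarrow>
      (\<exists>c\<in>carrier A. t = g \<otimes>\<^bsub>H b\<^esub> \<phi> b c)" for t
  proof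
    assume "\<exists>c\<in>carrier A. t = g \<otimes>\<^bsub>H b\<^esub> \<phi> b a \<otimes>\<^bsub>H b\<^esub> \<phi> b c"
    then obtain c where "c \<in> carrier A" "t = g \<otimes>\<^bsub>H b\<^esub> \<phi> b a \<otimes>\<^bsub>H b\<^esub> \<phi> b c" by blast
    then show "\<exists>c\<in>carrier A. t = g \<otimes>\<^bsub>H b\<^esub> \<phi> b c"
      using assms by (intro bexI[of _ "a \<otimes>\<^bsub>A\<^esub> c"]) (auto simp: H.m_assoc)
  next
    assume "\<exists>c\<in>carrier A. t = g \<otimes>\<^bsub>H b\<^esub> \<phi> b c"
    then obtain c where "c \<in> carrier A" "t = g \<otimes>\<^bsub>H b\<^esub> \<phi> b c" by blast
    then show "\<exists>c\<in>carrier A. t = g \<otimes>\<^bsub>H b\<^esub> \<phi> b a \<otimes>\<^bsub>H b\<^esub> \<phi> b c"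
      using assms by (intro bexI[of _ "inv\<^bsub>A\<^esub> a \<otimes>\<^bsub>A\<^esub> c"])
        (auto simp: H.m_assoc simp flip: \<phi>.hom_mult A.m_assoc)
  qed
  then show ?thesis using assms by (simp add: rep_def)
qed

lemma rep_rep [simp]: "g \<in> carrier (H b) \<Longrightarrow> rep b (rep b g) = rep b g"
  using rep_coset[of g b] by auto

lemma amal_part_props:
  assumes "g \<in> carrier (H b)"
  shows amal_part_closed [simp]: "amal_part b g \<in> carrier A"
    and rep_amal_part: "rep b g \<otimes>\<^bsub>H b\<^esub> \<phi> b (amal_part b g) = g"
proof -
  obtain a where a: "a \<in> carrier A" "rep b g = g \<otimes>\<^bsub>H b\<^esub> \<phi> b a" using rep_coset[OF assms] by blast
  then have "inv\<^bsub>H b\<^esub> (rep b g) \<otimes>\<^bsub>H b\<^esub> g = \<phi> b (inv\<^bsub>A\<^esub> a)"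
    using assms by (simp add: H.inv_mult_group H.m_assoc)
  then have img: "inv\<^bsub>H b\<^esub> (rep b g) \<otimes>\<^bsub>H b\<^esub> g \<in> \<phi> b ` carrier A"
    using a by (simp only: imageI A.inv_closed)
  show "amal_part b g \<in> carrier A" using inv_into_into[OF img] by (simp add: amal_part_def)
  show "rep b g \<otimes>\<^bsub>H b\<^esub> \<phi> b (amal_part b g) = g"
    using f_inv_into_f[OF img] assms by (simp add: amal_part_def flip: H.m_assoc)
qed

lemma amal_part_eqI:
  assumes "g \<in> carrier (H b)" "a \<in> carrier A" "rep b g \<otimes>\<^bsub>H b\<^esub> \<phi> b a = g"
  shows "amal_part b g = a"
proof -
  have "rep b g \<otimes>\<^bsub>H b\<^esub> \<phi> b (amal_part b g) = rep b g \<otimes>\<^bsub>H b\<^esub> \<phi> b a"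
    using rep_amal_part[OF assms(1)] assms(3) by simp
  then show ?thesis using assms(1,2) by simp
qed

definition starts :: "bool \<Rightarrow> (bool \<times> 'g) list \<Rightarrow> bool" where
  "starts b s \<longleftrightarrow> s \<noteq> [] \<and> fst (hd s) = b"

lemma starts_simps [simp]: "\<not> starts b []" "starts b (x # s) \<longleftrightarrow> fst x = b"
  by (auto simp: starts_def)

text \<open>The normal form \<open>t\<^sub>1 \<cdots> t\<^sub>n a\<close> is stored as \<open>(a, [t\<^sub>n, \<dots>, t\<^sub>1])\<close>, each \<open>t\<^sub>i\<close> tagged with its factor: the
  group acts from the right, so the last syllable is at the top.\<close>

fun stack :: "(bool \<times> 'g) list \<Rightarrow> bool" where
  "stack [] \<longleftrightarrow> True"
| "stack ((b, t) # s) \<longleftrightarrow>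
    t \<in> carrier (H b) \<and> t \<notin> amal b \<and> rep b t = t \<and> \<not> starts b s \<and> stack s"

definition states :: "('a \<times> (bool \<times> 'g) list) set" where
  "states = {(a, s). a \<in> carrier A \<and> stack s}"

text \<open>For either factor \<open>b\<close>, a normal form splits uniquely into a last part in \<open>H b\<close>, possibly in the
  amalgamated subgroup, and a stack that does not end in that factor. \<open>pop b\<close> is this splitting and \<open>push b\<close>
  is its inverse (\<open>push_pop\<close> and \<open>pop_push\<close>). An element of \<open>H b\<close> acts by right multiplication on the first
  component; that this is a group action is then immediate.\<close>

fun pop :: "bool \<Rightarrow> 'a \<times> (bool \<times> 'g) list \<Rightarrow> 'g \<times> (bool \<times> 'g) list" where
  "pop b (a, s) = (if starts b s then (snd (hd s) \<otimes>\<^bsub>H b\<^esub> \<phi> b a, tl s) else (\<phi> b a, s))"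

fun push :: "bool \<Rightarrow> 'g \<times> (bool \<times> 'g) list \<Rightarrow> 'a \<times> (bool \<times> 'g) list" where
  "push b (g, s) = (amal_part b g, if g \<in> amal b then s else (b, rep b g) # s)"

fun act :: "'a \<times> (bool \<times> 'g) list \<Rightarrow> bool \<times> 'g \<Rightarrow> 'a \<times> (bool \<times> 'g) list" where
  "act st (b, g) = push b (fst (pop b st) \<otimes>\<^bsub>H b\<^esub> g, snd (pop b st))"

abbreviation start :: "'a \<times> (bool \<times> 'g) list" where
  "start \<equiv> (\<one>\<^bsub>A\<^esub>, [])"

definition tagged :: "(bool \<times> 'g) set" where
  "tagged = {(b, g). g \<in> carrier (H b)}"

lemma tagged_iff [simp]: "(b, g) \<in> tagged \<longleftrightarrow> g \<in> carrier (H b)"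
  by (simp add: tagged_def)

lemma start_states [simp]: "start \<in> states"
  by (simp add: states_def)

lemma pop_closed:
  assumes "st \<in> states"
  shows "fst (pop b st) \<in> carrier (H b)" "stack (snd (pop b st))" "\<not> starts b (snd (pop b st))"
proof -
  obtain a s where st: "st = (a, s)" "a \<in> carrier A" "stack s" using assms by (auto simp: states_def)
  show "fst (pop b st) \<in> carrier (H b)" "stack (snd (pop b st))" "\<not> starts b (snd (pop b st))"
    using st by (cases s; auto)+
qed

lemma push_closed:
  assumes "g \<in> carrier (H b)" "stack s" "\<not> starts b s"
  shows "push b (g, s) \<in> states"
  using assms by (simp add: states_def)

lemma push_pop:
  assumes "st \<in> states"
  shows "push b (pop b st) = st"
proof -
  obtain a s where st: "st = (a, s)" "a \<in> carrier A" "stack s" using assms by (auto simp: states_def)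
  show ?thesis
  proof (cases "starts b s")
    case True
    then obtain t r where "s = (b, t) # r" by (cases s) auto
    then show ?thesis using st by (auto intro!: amal_part_eqI)
  next
    case False
    then show ?thesis using st by (auto intro!: amal_part_eqI simp: rep_def)
  qed
qed

lemma pop_push:
  assumes "g \<in> carrier (H b)" "stack s" "\<not> starts b s"
  shows "pop b (push b (g, s)) = (g, s)"
  using assms rep_amal_part[OF assms(1)] by (auto simp: rep_def)

lemma act_closed [simp]:
  assumes "st \<in> states" "x \<in> tagged"
  shows "act st x \<in> states"
  using assms pop_closed[OF assms(1)] by (cases x) (simp only: act.simps, intro push_closed, auto)

lemma foldl_act_closed [simp]:
  "st \<in> states \<Longrightarrow> w \<in> lists tagged \<Longrightarrow> foldl act st w \<in> states"
  by (induction w arbitrary: st) auto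

lemma act_mult:
  assumes "st \<in> states" "g \<in> carrier (H b)" "g' \<in> carrier (H b)"
  shows "act (act st (b, g)) (b, g') = act st (b, g \<otimes>\<^bsub>H b\<^esub> g')"
  using assms pop_closed[OF assms(1), of b] by (simp only: act.simps) (subst pop_push, auto simp: H.m_assoc)

lemma act_one:
  assumes "st \<in> states"
  shows "act st (b, \<one>\<^bsub>H b\<^esub>) = st"
  using pop_closed[OF assms, of b] push_pop[OF assms, of b] by (simp del: pop.simps push.simps)

text \<open>The right-hand side does not mention \<open>b\<close>: the actions of the two factors agree on \<open>A\<close>.\<close>

lemma act_\<phi>:
  assumes "st \<in> states" "a \<in> carrier A"
  shows "act st (b, \<phi> b a) = (fst st \<otimes>\<^bsub>A\<^esub> a, snd st)"
proof -
  obtain c s where st: "st = (c, s)" "c \<in> carrier A" "stack s" using assms by (auto simp: states_def)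
  have "(c \<otimes>\<^bsub>A\<^esub> a, s) \<in> states" using st assms by (simp add: states_def)
  from push_pop[OF this, of b] show ?thesis
    using st assms pop_closed(1)[OF assms(1), of b] by (cases s) (auto simp: H.m_assoc split: if_splits)
qed

lemma act_local: "act (a, s) x = (fst (act (a, take 1 s) x), snd (act (a, take 1 s) x) @ drop 1 s)"
  by (cases s; cases x) auto

lemma stack_take: "stack s \<Longrightarrow> stack (take n s)"
proof (induction s arbitrary: n rule: stack.induct)
  case (2 b t s)
  then show ?case by (cases n; cases s) (auto simp: starts_def take_Cons')
qed simp

end

section \<open>Conjugation in an amalgamated product\<close>

(* Membership in lists stays folded: the simplification rules for Nil, Cons and append suffice. *)
declare in_listsD [rule del] in_listsI [rule del]

text \<open>The group \<open>G\<close> is characterised by its elements being products from the factors, and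
  by the action on normal forms factoring through it. The latter is the consequence of the universal property
  that is needed, and it can be stated without quantifying over all target groups.\<close>

locale amalgamated_product = amalgam H A \<phi> + G: group G
  for H :: "bool \<Rightarrow> ('g, 'h) monoid_scheme"
    and A :: "('a, 'm) monoid_scheme"
    and \<phi> :: "bool \<Rightarrow> 'a \<Rightarrow> 'g"
    and G :: "('c, 'k) monoid_scheme" (structure) +
  fixes \<iota> :: "bool \<Rightarrow> 'g \<Rightarrow> 'c"
  assumes \<iota>_hom: "\<And>b. \<iota> b \<in> hom (H b) G"
    and \<iota>_\<phi>: "\<And>a b b'. a \<in> carrier A \<Longrightarrow> \<iota> b (\<phi> b a) = \<iota> b' (\<phi> b' a)"
    and generated: "\<And>x. x \<in> carrier G \<Longrightarrow>
      \<exists>w\<in>lists tagged. foldr (\<lambda>(b, g) y. \<iota> b g \<otimes> y) w \<one> = x"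
    and faithful: "\<And>u v. u \<in> lists tagged \<Longrightarrow> v \<in> lists tagged \<Longrightarrow>
      foldr (\<lambda>(b, g) y. \<iota> b g \<otimes> y) u \<one> = foldr (\<lambda>(b, g) y. \<iota> b g \<otimes> y) v \<one> \<Longrightarrow>
      foldl act start u = foldl act start v"
begin

sublocale \<iota>: group_hom "H b" G "\<iota> b" for b
  using \<iota>_hom by unfold_locales

definition ev :: "(bool \<times> 'g) list \<Rightarrow> 'c" where
  "ev w = foldr (\<lambda>(b, g) y. \<iota> b g \<otimes> y) w \<one>"

lemma ev_simps [simp]: "ev [] = \<one>" "ev ((b, g) # w) = \<iota> b g \<otimes> ev w"
  by (simp_all add: ev_def)

lemma ev_closed [simp]: "w \<in> lists tagged \<Longrightarrow> ev w \<in> carrier G"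
  by (induction w) auto

lemma ev_append [simp]: "u \<in> lists tagged \<Longrightarrow> v \<in> lists tagged \<Longrightarrow> ev (u @ v) = ev u \<otimes> ev v"
  by (induction u) (auto simp: G.m_assoc)

lemma stack_tagged: "stack s \<Longrightarrow> s \<in> lists tagged"
  by (induction s rule: stack.induct) auto

definition val :: "'a \<times> (bool \<times> 'g) list \<Rightarrow> 'c" where
  "val st = ev (rev (snd st)) \<otimes> \<iota> True (\<phi> True (fst st))"

lemma rev_tagged [simp]: "rev s \<in> lists tagged \<longleftrightarrow> s \<in> lists tagged"
  by (auto simp: in_lists_conv_set)

lemma val_push:
  assumes "g \<in> carrier (H b)" "stack s"
  shows "val (push b (g, s)) = ev (rev s) \<otimes> \<iota> b g"
proof -
  note s = stack_tagged[OF assms(2)]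
  have "\<iota> b g = \<iota> b (rep b g) \<otimes> \<iota> b (\<phi> b (amal_part b g))"
    using assms rep_amal_part[OF assms(1)] by (simp flip: \<iota>.hom_mult)
  also have "\<iota> b (\<phi> b (amal_part b g)) = \<iota> True (\<phi> True (amal_part b g))"
    using assms by (intro \<iota>_\<phi>) simp
  finally have g: "\<iota> b g = \<iota> b (rep b g) \<otimes> \<iota> True (\<phi> True (amal_part b g))" .
  show ?thesis
  proof (cases "g \<in> amal b")
    case True
    then have "rep b g = \<one>\<^bsub>H b\<^esub>" by (simp add: rep_def)
    then show ?thesis using True g assms s by (simp add: val_def)
  next
    case False
    then show ?thesis using g assms s by (simp add: val_def G.m_assoc)
  qed
qed

text \<open>Together with \<open>val_push\<close> this shows that the action of \<open>x\<close> multiplies the value by \<open>x\<close>, without a case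
  distinction on the stack.\<close>

lemma val_pop:
  assumes "st \<in> states"
  shows "val st = ev (rev (snd (pop b st))) \<otimes> \<iota> b (fst (pop b st))"
  using val_push[OF pop_closed(1)[OF assms, of b] pop_closed(2)[OF assms, of b]] push_pop[OF assms, of b]
  by (simp del: push.simps pop.simps)

lemma val_act:
  assumes st: "st \<in> states" and g: "g \<in> carrier (H b)"
  shows "val (act st (b, g)) = val st \<otimes> \<iota> b g"
  using pop_closed[OF st, of b] stack_tagged[OF pop_closed(2)[OF st, of b]] g
  by (simp add: val_pop[OF st, of b] val_push G.m_assoc del: push.simps pop.simps)

lemma val_closed [simp]: "st \<in> states \<Longrightarrow> val st \<in> carrier G"
  using stack_tagged by (auto simp: val_def states_def)

lemma val_foldl_act:
  assumes "st \<in> states" "w \<in> lists tagged"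
  shows "val (foldl act st w) = val st \<otimes> ev w"
  using assms by (induction w arbitrary: st) (auto simp: val_act G.m_assoc simp del: act.simps)

lemma val_start: "val start = \<one>"
  by (simp add: val_def)

definition normal :: "'c \<Rightarrow> 'a \<times> (bool \<times> 'g) list" where
  "normal x = foldl act start (SOME w. w \<in> lists tagged \<and> ev w = x)"

lemma normal_ev:
  assumes "w \<in> lists tagged"
  shows "normal (ev w) = foldl act start w"
proof -
  have "\<exists>u. u \<in> lists tagged \<and> ev u = ev w" using assms by blast
  from someI_ex[OF this] show ?thesis
    unfolding normal_def using assms by (intro faithful) (auto simp: ev_def)
qed

lemma obtain_tagged:
  assumes "x \<in> carrier G"
  obtains w where "w \<in> lists tagged" "ev w = x"
  using generated[OF assms] by (auto simp: ev_def)

lemma val_normal: "x \<in> carrier G \<Longrightarrow> val (normal x) = x"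
  by (erule obtain_tagged) (auto simp: normal_ev val_foldl_act val_start)

lemma normal_states: "x \<in> carrier G \<Longrightarrow> normal x \<in> states"
  by (erule obtain_tagged) (auto simp: normal_ev)

text \<open>The syllable length. In terms of the Bass-Serre tree it measures how far \<open>x\<close> moves the edge
  stabilised by \<open>A\<close>.\<close>

definition len :: "'c \<Rightarrow> nat" where
  "len x = length (snd (normal x))"

fun reduced :: "(bool \<times> 'g) list \<Rightarrow> bool" where
  "reduced [] \<longleftrightarrow> True"
| "reduced ((b, g) # w) \<longleftrightarrow> g \<in> carrier (H b) \<and> g \<notin> amal b \<and> \<not> starts b w \<and> reduced w"

lemma reduced_tagged: "reduced w \<Longrightarrow> w \<in> lists tagged"
  by (induction w rule: reduced.induct) auto

lemma reduced_append:
  "reduced (u @ v) \<longleftrightarrow>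
    reduced u \<and> reduced v \<and> (u \<noteq> [] \<longrightarrow> v \<noteq> [] \<longrightarrow> fst (last u) \<noteq> fst (hd v))"
  by (induction u rule: reduced.induct) (auto simp: starts_def)

lemma stack_reduced: "stack s \<Longrightarrow> reduced (rev s)"
  by (induction s rule: stack.induct) (auto simp: reduced_append starts_def last_rev)

lemma length_act_le: "length (snd (act st x)) \<le> Suc (length (snd st))"
  by (cases st; cases x) auto

lemma length_foldl_act_le: "length (snd (foldl act st w)) \<le> length (snd st) + length w"
proof (induction w arbitrary: st)
  case (Cons x w)
  show ?case using Cons[of "act st x"] length_act_le[of st x] by (simp del: act.simps)
qed simp

lemma len_ev_le: "w \<in> lists tagged \<Longrightarrow> len (ev w) \<le> length w"
  using length_foldl_act_le[of start w] by (simp add: len_def normal_ev)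

text \<open>Each syllable of a reduced word lies outside the amalgamated subgroup and in the factor
  opposite to the top of the stack, hence is pushed onto it.\<close>

lemma length_foldl_act_reduced:
  assumes "reduced w" "st \<in> states" "w \<noteq> [] \<Longrightarrow> \<not> starts (fst (hd w)) (snd st)"
  shows "length (snd (foldl act st w)) = length (snd st) + length w"
  using assms
proof (induction w arbitrary: st rule: reduced.induct)
  case (2 b g w)
  obtain a s where st: "st = (a, s)" "a \<in> carrier A" "\<not> starts b s"
    using 2 by (cases st) (auto simp: states_def)
  then have act: "snd (act st (b, g)) = (b, rep b (\<phi> b a \<otimes>\<^bsub>H b\<^esub> g)) # s"
    using 2 by simp
  have "length (snd (foldl act (act st (b, g)) w)) = length (snd (act st (b, g))) + length w"
    using 2 act by (intro "2.IH") (auto simp: starts_def simp del: act.simps)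
  then show ?case using st act by (simp del: act.simps)
qed simp

lemma len_ev_reduced: "reduced w \<Longrightarrow> len (ev w) = length w"
  using length_foldl_act_reduced[of w start] by (simp add: len_def normal_ev reduced_tagged)

text \<open>The component in \<open>A\<close> is absorbed by the last syllable of the normal form, if there is one.\<close>

lemma reduced_expression:
  assumes "x \<in> carrier G"
  shows "(\<exists>a\<in>carrier A. \<forall>b. x = \<iota> b (\<phi> b a)) \<or> (\<exists>w. reduced w \<and> ev w = x)"
proof -
  obtain a s where n: "normal x = (a, s)" by fastforce
  have as: "a \<in> carrier A" "stack s" "x = ev (rev s) \<otimes> \<iota> True (\<phi> True a)"
    using normal_states[OF assms] val_normal[OF assms, symmetric] unfolding n
    by (simp_all add: states_def val_def)
  show ?thesis
  proof (cases s)
    case Nil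
    then have "x = \<iota> b (\<phi> b a)" for b using as \<iota>_\<phi>[of a True b] by simp
    then show ?thesis using as(1) by blast
  next
    case (Cons y r)
    obtain b t where s: "s = (b, t) # r" using Cons by (cases y) auto
    let ?w = "rev r @ [(b, t \<otimes>\<^bsub>H b\<^esub> \<phi> b a)]"
    have red: "reduced (rev r)" "reduced (rev s)"
      using as(2) stack_reduced[of r] stack_reduced[of s] s by simp_all
    then have "reduced ?w" using as s by (auto simp: reduced_append)
    moreover have "ev ?w = x"
      using as s reduced_tagged[OF red(1)] \<iota>_\<phi>[of a b True] by (simp add: G.m_assoc)
    ultimately show ?thesis by blast
  qed
qed

text \<open>Such a word can stand between two syllables from the factor \<open>b\<close> without any cancellation.\<close>

definition between :: "bool \<Rightarrow> (bool \<times> 'g) list \<Rightarrow> bool" where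
  "between b m \<longleftrightarrow> reduced m \<and> m \<noteq> [] \<and> fst (hd m) \<noteq> b \<and> fst (last m) \<noteq> b"

lemma between_tagged: "between b m \<Longrightarrow> m \<in> lists tagged"
  by (simp add: between_def reduced_tagged del: in_lists_conv_set)

lemma between_surround:
  assumes "between b m" "g \<in> carrier (H b)" "g' \<in> carrier (H b)" "g \<notin> amal b" "g' \<notin> amal b"
  shows "between (\<not> b) ((b, g) # m @ [(b, g')])"
  using assms by (auto simp: between_def reduced_append starts_def)

text \<open>An element of the amalgamated subgroup also lies in the other factor, where it merges with the
  neighbouring syllable.\<close>

lemma absorb_left:
  assumes m: "between b m" and c: "c \<in> amal b"
  shows "\<exists>m'. between b m' \<and> length m' = length m \<and> ev m' = \<iota> b c \<otimes> ev m"
proof -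
  obtain b' x r where mx: "m = (b', x) # r" using m by (cases m) (auto simp: between_def)
  obtain a where a: "a \<in> carrier A" "c = \<phi> b a" using c by (auto simp: amal_def)
  have t: "x \<in> carrier (H b')" "r \<in> lists tagged" using between_tagged[OF m] mx by auto
  show ?thesis
  proof (intro exI conjI)
    show "between b ((b', \<phi> b' a \<otimes>\<^bsub>H b'\<^esub> x) # r)"
      using m mx a t by (auto simp: between_def)
    show "ev ((b', \<phi> b' a \<otimes>\<^bsub>H b'\<^esub> x) # r) = \<iota> b c \<otimes> ev m"
      using a t mx \<iota>_\<phi>[of a b b'] by (simp add: G.m_assoc del: in_lists_conv_set)
  qed (use mx in simp)
qed

lemma absorb_right:
  assumes m: "between b m" and c: "c \<in> amal b"
  shows "\<exists>m'. between b m' \<and> length m' = length m \<and> ev m' = ev m \<otimes> \<iota> b c"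
proof -
  obtain b' x r where mx: "m = r @ [(b', x)]"
    using m by (cases m rule: rev_cases) (auto simp: between_def)
  obtain a where a: "a \<in> carrier A" "c = \<phi> b a" using c by (auto simp: amal_def)
  have t: "x \<in> carrier (H b')" "r \<in> lists tagged" using between_tagged[OF m] mx by auto
  have hd: "fst (hd (r @ [(d, y)])) = (if r = [] then d else fst (hd r))" for d :: bool and y
    by (cases r) auto
  show ?thesis
  proof (intro exI conjI)
    show "between b (r @ [(b', x \<otimes>\<^bsub>H b'\<^esub> \<phi> b' a)])"
      using m a t by (auto simp: mx between_def reduced_append hd split: if_splits)
    show "ev (r @ [(b', x \<otimes>\<^bsub>H b'\<^esub> \<phi> b' a)]) = ev m \<otimes> \<iota> b c"
      using a t mx \<iota>_\<phi>[of a b b'] by (simp add: G.m_assoc)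
  qed (use mx in simp)
qed

lemma len_sandwich:
  assumes m: "between b m" and g: "g \<in> carrier (H b)" "g' \<in> carrier (H b)"
  shows "len (\<iota> b g \<otimes> ev m \<otimes> \<iota> b g') =
    length m + (if g \<in> amal b then 0 else 1) + (if g' \<in> amal b then 0 else 1)"
proof -
  \<comment> \<open>The outer factors that remain syllables of their own; the others are absorbed by \<open>m\<close>.\<close>
  define p where "p = (if g \<in> amal b then [] else [(b, g)])"
  define q where "q = (if g' \<in> amal b then [] else [(b, g')])"
  obtain m1 where m1: "between b m1" "length m1 = length m" "ev (p @ m1) = \<iota> b g \<otimes> ev m"
  proof (cases "g \<in> amal b")
    case True
    then show ?thesis using absorb_left[OF m, of g] that by (auto simp: p_def)
  next
    case False
    then show ?thesis using that[of m] m by (simp add: p_def)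
  qed
  obtain m2 where m2: "between b m2" "length m2 = length m1" "ev (m2 @ q) = ev m1 \<otimes> \<iota> b g'"
  proof (cases "g' \<in> amal b")
    case True
    then show ?thesis using absorb_right[OF m1(1), of g'] that by (auto simp: q_def)
  next
    case False
    then show ?thesis using that[of m1] m1 between_tagged[OF m1(1)] g by (simp add: q_def)
  qed
  have t: "p \<in> lists tagged" "q \<in> lists tagged" using g by (auto simp: p_def q_def)
  have "reduced (p @ m2 @ q)"
    using m2(1) g by (auto simp: p_def q_def between_def reduced_append starts_def)
  from len_ev_reduced[OF this]
  have "len (ev (p @ m2 @ q)) = length p + length m + length q" using m1 m2 by simp
  also have "ev (p @ m2 @ q) = ev p \<otimes> ev (m2 @ q)"
    using t between_tagged[OF m2(1)] by (intro ev_append) auto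
  also have "\<dots> = \<iota> b g \<otimes> ev m \<otimes> \<iota> b g'"
    using t m1 m2 between_tagged[OF m1(1)] g by (simp add: G.m_assoc[symmetric])
  finally show ?thesis by (simp add: p_def q_def)
qed

text \<open>Splitting off a possible first and a possible last syllable in \<open>H b\<close>: conjugation by an element
  of \<open>H b\<close> then changes only the two outer factors. The first alternative covers the elements for which
  nothing is left in between.\<close>

lemma sandwich_exists:
  assumes "x \<in> carrier G"
  shows "(\<exists>g\<in>carrier (H b). x = \<iota> b g) \<or>
    (\<exists>g\<in>carrier (H b). \<exists>g'\<in>carrier (H b). \<exists>m. between b m \<and> x = \<iota> b g \<otimes> ev m \<otimes> \<iota> b g')"
  using reduced_expression[OF assms]
proof
  assume "\<exists>w. reduced w \<and> ev w = x"
  then obtain w where w: "reduced w" "ev w = x" by blast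
  obtain g w' where gw: "g \<in> carrier (H b)" "reduced w'" "\<not> starts b w'" "x = \<iota> b g \<otimes> ev w'"
  proof (cases "starts b w")
    case True
    then obtain y r where "w = (b, y) # r" by (cases w) auto
    then show ?thesis using that[of y r] w by simp
  next
    case False
    then show ?thesis using that[of "\<one>\<^bsub>H b\<^esub>" w] w assms by simp
  qed
  show ?thesis
  proof (cases w' rule: rev_cases)
    case Nil
    then show ?thesis using gw by auto
  next
    case (snoc r y)
    obtain c z where y: "y = (c, z)" by fastforce
    have rz: "r \<in> lists tagged" "z \<in> carrier (H c)" using reduced_tagged[OF gw(2)] snoc y by auto
    show ?thesis
    proof (cases "c = b")
      case True
      have "r \<noteq> []" using gw snoc y True by auto
      then have "between b r" using gw snoc y True by (auto simp: between_def reduced_append starts_def)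
      moreover have "x = \<iota> b g \<otimes> ev r \<otimes> \<iota> b z" using gw snoc y True rz by (simp add: G.m_assoc)
      ultimately show ?thesis using gw(1) rz True by blast
    next
      case False
      then have "between b w'" using gw snoc y by (auto simp: between_def starts_def)
      moreover have "x = \<iota> b g \<otimes> ev w' \<otimes> \<iota> b \<one>\<^bsub>H b\<^esub>"
        using gw reduced_tagged[OF gw(2)] by simp
      ultimately show ?thesis using gw(1) H.one_closed by blast
    qed
  qed
next
  assume "\<exists>a\<in>carrier A. \<forall>b. x = \<iota> b (\<phi> b a)"
  then obtain a where a: "a \<in> carrier A" "x = \<iota> b (\<phi> b a)" by blast
  show ?thesis by (rule disjI1, rule bexI[of _ "\<phi> b a"]) (use a in simp_all)
qed

abbreviation conjugate :: "'c \<Rightarrow> 'c \<Rightarrow> 'c" where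
  "conjugate g x \<equiv> g \<otimes> x \<otimes> inv g"

text \<open>Write \<open>x = g m g'\<close> as above. The length of \<open>x\<close> exceeds that of \<open>m\<close> by the number of outer factors
  outside the amalgamated subgroup, and the length of the conjugate \<open>(s g) m (g' s\<^sup>-\<^sup>1)\<close> likewise. If one of
  \<open>s g\<close>, \<open>g' s\<^sup>-\<^sup>1\<close> lay in the subgroup, then a growth in length would force \<open>g\<close> and \<open>g'\<close> into the subgroup,
  so that \<open>s g\<close> and \<open>g' s\<^sup>-\<^sup>1\<close> lie there if and only if \<open>s\<close> does. Then both lie there, and nothing grows.\<close>

lemma conjugate_longer_between:
  assumes x: "x \<in> carrier G" and s: "s \<in> carrier (H b)"
    and longer: "len x < len (conjugate (\<iota> b s) x)"
  shows "\<exists>m. between (\<not> b) m \<and> ev m = conjugate (\<iota> b s) x"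
  using sandwich_exists[OF x, of b]
proof
  assume "\<exists>g\<in>carrier (H b). x = \<iota> b g"
  then obtain g where g: "g \<in> carrier (H b)" "x = \<iota> b g" by blast
  define g' where "g' = s \<otimes>\<^bsub>H b\<^esub> g \<otimes>\<^bsub>H b\<^esub> inv\<^bsub>H b\<^esub> s"
  have g': "g' \<in> carrier (H b)" "conjugate (\<iota> b s) x = \<iota> b g'" using g s by (auto simp: g'_def)
  have "g' \<notin> amal b"
  proof
    assume "g' \<in> amal b"
    then obtain a where a: "a \<in> carrier A" "g' = \<phi> b a" by (auto simp: amal_def)
    have "normal (\<iota> b g') = act start (b, g')" using normal_ev[of "[(b, g')]"] g' by simp
    then have "len (\<iota> b g') = 0"
      using act_\<phi>[OF start_states a(1), of b] a(2) by (simp add: len_def del: act.simps)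
    then show False using longer g' by simp
  qed
  then show ?thesis using g' by (intro exI[of _ "[(b, g')]"]) (simp add: between_def)
next
  assume "\<exists>g\<in>carrier (H b). \<exists>g'\<in>carrier (H b). \<exists>m. between b m \<and> x = \<iota> b g \<otimes> ev m \<otimes> \<iota> b g'"
  then obtain g g' m where m: "g \<in> carrier (H b)" "g' \<in> carrier (H b)" "between b m"
    "x = \<iota> b g \<otimes> ev m \<otimes> \<iota> b g'" by blast
  let ?l = "s \<otimes>\<^bsub>H b\<^esub> g" and ?r = "g' \<otimes>\<^bsub>H b\<^esub> inv\<^bsub>H b\<^esub> s"
  note t = between_tagged[OF m(3)]
  have y: "conjugate (\<iota> b s) x = \<iota> b ?l \<otimes> ev m \<otimes> \<iota> b ?r" using m s t by (simp add: G.m_assoc)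
  have len_x: "len x = length m + (if g \<in> amal b then 0 else 1) + (if g' \<in> amal b then 0 else 1)"
    unfolding m(4) using m by (intro len_sandwich) auto
  have len_y: "len (conjugate (\<iota> b s) x) =
      length m + (if ?l \<in> amal b then 0 else 1) + (if ?r \<in> amal b then 0 else 1)"
    unfolding y using m s by (intro len_sandwich) auto
  have "?l \<notin> amal b \<and> ?r \<notin> amal b"
    using longer m(1,2) s unfolding len_x len_y by (auto split: if_splits)
  then show ?thesis
    using between_surround[OF m(3), of ?l ?r] m s t y
    by (intro exI[of _ "(b, ?l) # m @ [(b, ?r)]"]) (simp add: G.m_assoc)
qed

lemma conjugate_between:
  assumes "between b m" "s \<in> carrier (H b)" "s \<notin> amal b"
  shows "\<exists>m'. between (\<not> b) m' \<and> ev m' = conjugate (\<iota> b s) (ev m) \<and> length m \<le> length m'"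
  using between_surround[OF assms(1), of s "inv\<^bsub>H b\<^esub> s"] between_tagged[OF assms(1)] assms
  by (intro exI[of _ "(b, s) # m @ [(b, inv\<^bsub>H b\<^esub> s)]"]) (simp add: G.m_assoc)

lemma conjugate_mult:
  assumes "g \<in> carrier G" "g' \<in> carrier G" "x \<in> carrier G"
  shows "conjugate (g \<otimes> g') x = conjugate g (conjugate g' x)"
  using assms by (simp add: G.inv_mult_group G.m_assoc)

text \<open>Since \<open>u\<close> is reduced, its syllables alternate between the factors, and each one meets a word that
  begins and ends in the other factor.\<close>

lemma len_conjugate_between:
  assumes "reduced u" "between b m" "u \<noteq> [] \<Longrightarrow> fst (last u) = b"
  shows "length m \<le> len (conjugate (ev u) (ev m))"
  using assms
proof (induction u arbitrary: b m rule: rev_induct)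
  case Nil
  then show ?case using between_tagged[of b m] by (simp add: between_def len_ev_reduced)
next
  case (snoc y u)
  obtain s where y: "y = (b, s)" using snoc by (cases y) auto
  have s: "s \<in> carrier (H b)" "s \<notin> amal b" "reduced u" using snoc.prems y by (auto simp: reduced_append)
  obtain m' where m': "between (\<not> b) m'" "ev m' = conjugate (\<iota> b s) (ev m)" "length m \<le> length m'"
    using conjugate_between[OF snoc.prems(2) s(1,2)] by blast
  have "length m' \<le> len (conjugate (ev u) (ev m'))"
    using snoc.prems y s by (intro snoc.IH[OF _ m'(1)]) (auto simp: reduced_append)
  also have "conjugate (ev u) (ev m') = conjugate (ev (u @ [y])) (ev m)"
    using y s m' reduced_tagged[OF s(3)] between_tagged[OF snoc.prems(2)] by (simp add: conjugate_mult)
  finally show ?case using m'(3) by simp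
qed

text \<open>Conjugation by single factor elements among the elements of length at most \<open>M\<close>.\<close>

definition conjugate_steps :: "nat \<Rightarrow> ('c \<times> 'c) set" where
  "conjugate_steps M = {(x, y). x \<in> carrier G \<and> y \<in> carrier G \<and> len x \<le> M \<and> len y \<le> M \<and>
    (\<exists>b. \<exists>s\<in>carrier (H b). y = conjugate (\<iota> b s) x)}"

lemma conjugate_reduced_steps:
  assumes "reduced u" "x \<in> carrier G" "len x \<le> M" "len (conjugate (ev u) x) \<le> M"
  shows "(x, conjugate (ev u) x) \<in> (conjugate_steps M)\<^sup>*"
  using assms
proof (induction u arbitrary: x rule: rev_induct)
  case Nil
  then show ?case by simp
next
  case (snoc y u)
  obtain b s where y: "y = (b, s)" by fastforce
  have s: "s \<in> carrier (H b)" "reduced u" using snoc.prems y by (auto simp: reduced_append)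
  have eq: "conjugate (ev (u @ [y])) x = conjugate (ev u) (conjugate (\<iota> b s) x)"
    using y s snoc.prems reduced_tagged[OF s(2)] by (simp add: conjugate_mult)
  \<comment> \<open>A first step beyond \<open>M\<close> would be a growth, after which the length could not return to \<open>M\<close>.\<close>
  have short: "len (conjugate (\<iota> b s) x) \<le> M"
  proof (rule ccontr)
    assume "\<not> len (conjugate (\<iota> b s) x) \<le> M"
    then have long: "M < len (conjugate (\<iota> b s) x)" by simp
    then obtain m where m: "between (\<not> b) m" "ev m = conjugate (\<iota> b s) x"
      using conjugate_longer_between[of x s b] snoc.prems s by auto
    have "length m \<le> len (conjugate (ev u) (ev m))"
      using snoc.prems y by (intro len_conjugate_between[OF s(2) m(1)]) (auto simp: reduced_append)
    moreover have "len (ev m) = length m"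
      using m(1) by (simp add: between_def len_ev_reduced)
    ultimately show False using long snoc.prems(4) unfolding eq m(2) by simp
  qed
  have "(x, conjugate (\<iota> b s) x) \<in> conjugate_steps M"
    using snoc.prems s short by (auto simp: conjugate_steps_def)
  moreover have "(conjugate (\<iota> b s) x, conjugate (ev u) (conjugate (\<iota> b s) x)) \<in> (conjugate_steps M)\<^sup>*"
    using snoc.prems s short eq by (intro snoc.IH) auto
  ultimately show ?case unfolding eq by (rule converse_rtrancl_into_rtrancl)
qed

theorem conjugate_chain:
  assumes x: "x \<in> carrier G" and g: "g \<in> carrier G" and M: "len x \<le> M" "len (conjugate g x) \<le> M"
  shows "(x, conjugate g x) \<in> (conjugate_steps M)\<^sup>*"
  using reduced_expression[OF g]
proof
  assume "\<exists>a\<in>carrier A. \<forall>b. g = \<iota> b (\<phi> b a)"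
  then obtain a where "a \<in> carrier A" "g = \<iota> True (\<phi> True a)" by blast
  then have "\<exists>b. \<exists>s\<in>carrier (H b). conjugate g x = conjugate (\<iota> b s) x"
    by (intro exI[of _ True] bexI[of _ "\<phi> True a"]) simp_all
  then have "(x, conjugate g x) \<in> conjugate_steps M"
    using x g M unfolding conjugate_steps_def by simp
  then show ?thesis by blast
next
  assume "\<exists>w. reduced w \<and> ev w = g"
  then show ?thesis using conjugate_reduced_steps x M by blast
qed

lemma normal_eq_iff: "x \<in> carrier G \<Longrightarrow> y \<in> carrier G \<Longrightarrow> normal x = normal y \<longleftrightarrow> x = y"
  by (metis val_normal)

text \<open>A path in a finite relation can be shortened to at most as many steps as the relation has pairs.
  The injective numbering \<open>f\<close>, bounded by \<open>N\<close> on the elements in question, stands in for counting them;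
  the codes of normal forms will provide it.\<close>

lemma conjugate_bounded:
  assumes x: "x \<in> carrier G" and g: "g \<in> carrier G" and M: "len x \<le> M" "len (conjugate g x) \<le> M"
    and f: "inj_on f (carrier G)" "\<And>y. y \<in> carrier G \<Longrightarrow> len y \<le> M \<Longrightarrow> f y < (N :: nat)"
  shows "\<exists>w\<in>lists tagged. length w \<le> N * N \<and> conjugate (ev w) x = conjugate g x"
proof -
  define V where "V = {y \<in> carrier G. len y \<le> M}"
  have V: "f ` V \<subseteq> {..<N}" "inj_on f V" using f by (auto simp: V_def intro: inj_on_subset)
  then have fin: "finite V" and "card V \<le> N"
    using inj_on_finite[OF V(2,1)] card_inj_on_le[OF V(2,1)] by auto
  have sub: "conjugate_steps M \<subseteq> V \<times> V" by (auto simp: conjugate_steps_def V_def)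
  then have fins: "finite (conjugate_steps M)" using fin finite_subset by blast
  have "card (conjugate_steps M) \<le> card V * card V"
    using card_mono[OF _ sub] fin by (simp add: card_cartesian_product)
  also have "\<dots> \<le> N * N" using \<open>card V \<le> N\<close> by (intro mult_mono) auto
  finally have card: "card (conjugate_steps M) \<le> N * N" .
  obtain n where n: "n \<le> card (conjugate_steps M)" "(x, conjugate g x) \<in> conjugate_steps M ^^ n"
    using conjugate_chain[OF x g M] unfolding rtrancl_finite_eq_relpow[OF fins] by blast
  have "\<exists>w\<in>lists tagged. length w \<le> n \<and> conjugate (ev w) x = y" if "(x, y) \<in> conjugate_steps M ^^ n" for n y
    using that
  proof (induction n arbitrary: y)
    case 0
    then show ?case using x by (intro bexI[of _ "[]"]) auto
  next
    case (Suc n)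
    then obtain z where z: "(x, z) \<in> conjugate_steps M ^^ n" "(z, y) \<in> conjugate_steps M" by auto
    obtain w where w: "w \<in> lists tagged" "length w \<le> n" "conjugate (ev w) x = z" using Suc.IH[OF z(1)] by auto
    obtain b s where s: "s \<in> carrier (H b)" "y = conjugate (\<iota> b s) z" using z(2) by (auto simp: conjugate_steps_def)
    have "conjugate (ev ((b, s) # w)) x = y"
      unfolding s(2) w(3)[symmetric] using s(1) w(1) x by (simp add: conjugate_mult)
    then show ?case using s(1) w by (intro bexI[of _ "(b, s) # w"]) simp_all
  qed
  from this[OF n(2)] show ?thesis using order_trans[OF _ order_trans[OF n(1) card]] by blast
qed

end

section \<open>The presented amalgam\<close>

lemma word_inv_word_inv [simp]: "word_inv (word_inv w) = w"
  by (simp add: word_inv_def rev_map comp_def)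

context finite_group_amalgam
begin

definition gens :: "bool \<Rightarrow> 'x set" where "gens b = (if b then X2 else X1)"
definition rels :: "bool \<Rightarrow> 'x word set" where "rels b = (if b then R2 else R1)"
definition \<phi> :: "bool \<Rightarrow> 'a \<Rightarrow> 'x word set" where "\<phi> b = (if b then \<phi>2 else \<phi>1)"
definition rep_word :: "bool \<Rightarrow> 'a \<Rightarrow> 'x word" where "rep_word b = (if b then w2 else w1)"
abbreviation factor :: "bool \<Rightarrow> 'x word set monoid" where
  "factor b \<equiv> presented_group (gens b) (rels b)"
abbreviation cls :: "bool \<Rightarrow> 'x word \<Rightarrow> 'x word set" where
  "cls b \<equiv> word_class (gens b) (rels b)"
definition X :: "'x set" where "X = X1 \<union> X2"
definition R :: "'x word set" where "R = amalgam_relators R1 R2 Y w1 w2"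
abbreviation G :: "'x word set monoid" where "G \<equiv> presented_group X R"

lemma words_mono: "w \<in> words (gens b) \<Longrightarrow> w \<in> words X"
  by (auto simp: words_def letters_def gens_def X_def in_lists_conv_set split: if_splits)

lemma letters_X_cases:
  assumes "l \<in> letters X"
  obtains b where "l \<in> letters (gens b)" "l \<in> letters X2 \<longleftrightarrow> b"
proof (cases "l \<in> letters X2")
  case True
  then show ?thesis using that[of True] by (simp add: gens_def)
next
  case False
  then show ?thesis using that[of False] assms by (auto simp: gens_def X_def letters_def)
qed

lemma letters_gens: "l \<in> letters (gens b) \<Longrightarrow> l \<in> letters X2 \<longleftrightarrow> b"
  using disjoint by (auto simp: gens_def split: if_splits)

lemma rels_words: "rels b \<subseteq> words (gens b)"
  using relators by (simp add: rels_def gens_def)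

lemma group_factor: "group (factor b)"
  using rels_words by (rule group_presented_group)

lemma carrier_factor: "carrier (factor b) = cls b ` words (gens b)"
  by (simp add: presented_group_def)

lemma cls_mult: "u \<in> words (gens b) \<Longrightarrow> v \<in> words (gens b) \<Longrightarrow>
    cls b u \<otimes>\<^bsub>factor b\<^esub> cls b v = cls b (u @ v)"
  by (rule presented_group_mult[OF rels_words])

lemma cls_one: "\<one>\<^bsub>factor b\<^esub> = cls b []"
  by (simp add: presented_group_def)

lemma mem_cls: "w \<in> words (gens b) \<Longrightarrow> w \<in> cls b w"
  by (simp add: word_class_def pres_eq.refl)

lemma cls_of_mem:
  assumes "C \<in> carrier (factor b)" "w \<in> C"
  shows "w \<in> words (gens b)" "C = cls b w"
proof -
  obtain u where u: "u \<in> words (gens b)" "C = cls b u" using assms by (auto simp: carrier_factor)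
  then have "pres_eq (gens b) (rels b) u w" using assms by (simp add: word_class_def)
  then show "w \<in> words (gens b)" "C = cls b w"
    using u pres_eq_words[OF rels_words] by (auto simp: word_class_eq_iff)
qed

lemma mon_\<phi>: "\<phi> b \<in> mon A (factor b)"
  using mono by (simp add: \<phi>_def gens_def rels_def)

lemma \<phi>_rep_word:
  assumes "a \<in> Y"
  shows "rep_word b a \<in> words (gens b)" "\<phi> b a = cls b (rep_word b a)"
proof -
  have "\<phi> b a \<in> carrier (factor b)"
    using mon_\<phi>[of b] assms generators_A by (auto simp: mon_def hom_def)
  moreover have "rep_word b a \<in> \<phi> b a"
    using representatives assms by (simp add: \<phi>_def rep_word_def)
  ultimately show "rep_word b a \<in> words (gens b)" "\<phi> b a = cls b (rep_word b a)"
    using cls_of_mem by blast+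
qed

lemma R_eq: "R = rels False \<union> rels True \<union> {rep_word False a @ word_inv (rep_word True a) | a. a \<in> Y}"
  by (simp add: R_def amalgam_relators_def rels_def rep_word_def)

lemma R_words: "R \<subseteq> words X"
  using rels_words \<phi>_rep_word(1) words_mono unfolding R_eq by fastforce

lemma pres_eq_factor:
  assumes "pres_eq (gens b) (rels b) u v"
  shows "pres_eq X R u v"
  using assms
proof induction
  case (cancel u v l)
  then show ?case using words_mono[of "[l]" b] by (intro pres_eq.cancel) (auto simp: words_mono)
next
  case (relator u v r)
  then have "r \<in> R" by (cases b) (auto simp: R_eq)
  then show ?case using relator by (intro pres_eq.relator) (auto simp: words_mono)
qed (auto intro: pres_eq.intros words_mono)

abbreviation cl :: "'x word \<Rightarrow> 'x word set" where
  "cl \<equiv> word_class X R"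

lemma carrier_G: "carrier G = cl ` words X"
  by (simp add: presented_group_def)

lemma cl_mult: "u \<in> words X \<Longrightarrow> v \<in> words X \<Longrightarrow> cl u \<otimes>\<^bsub>G\<^esub> cl v = cl (u @ v)"
  by (rule presented_group_mult[OF R_words])

lemma cl_one: "\<one>\<^bsub>G\<^esub> = cl []"
  by (simp add: presented_group_def)

lemma group_G: "group G"
  using R_words by (rule group_presented_group)

lemma cl_inv: "w \<in> words X \<Longrightarrow> inv\<^bsub>G\<^esub> (cl w) = cl (word_inv w)"
  by (rule group.inv_equality[OF group_G])
    (auto simp: cl_mult cl_one carrier_G word_class_eq_iff pres_eq_word_inv)

text \<open>Equality in a factor implies equality in \<open>G\<close>, so the value does not depend on the chosen word.\<close>

definition \<iota> :: "bool \<Rightarrow> 'x word set \<Rightarrow> 'x word set" where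
  "\<iota> b C = cl (SOME w. w \<in> C)"

lemma \<iota>_cls:
  assumes "w \<in> words (gens b)"
  shows "\<iota> b (cls b w) = cl w"
proof -
  have "(SOME u. u \<in> cls b w) \<in> cls b w" using mem_cls[OF assms] by (rule someI)
  then have "pres_eq X R w (SOME u. u \<in> cls b w)"
    by (intro pres_eq_factor[of b]) (simp add: word_class_def)
  then show ?thesis using assms words_mono by (simp add: \<iota>_def flip: word_class_eq_iff)
qed

lemma \<iota>_hom: "\<iota> b \<in> hom (factor b) G"
  by (rule homI) (auto simp: carrier_factor \<iota>_cls cls_mult cl_mult carrier_G words_mono)

lemma \<iota>_\<phi>_generator:
  assumes "a \<in> Y"
  shows "\<iota> False (\<phi> False a) = \<iota> True (\<phi> True a)"
proof -
  interpret G: group G by (rule group_G)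
  let ?u = "rep_word False a" and ?v = "rep_word True a"
  have w: "?u \<in> words X" "?v \<in> words X" using \<phi>_rep_word(1)[OF assms] words_mono by auto
  have "pres_eq X R ([] @ (?u @ word_inv ?v) @ []) ([] @ [])"
    using assms by (intro pres_eq.relator) (auto simp: R_eq)
  then have "cl (?u @ word_inv ?v) = \<one>\<^bsub>G\<^esub>" using w by (simp add: cl_one word_class_eq_iff)
  moreover have c: "cl ?u \<in> carrier G" "cl ?v \<in> carrier G" using w by (simp_all add: carrier_G)
  ultimately have "cl ?u \<otimes>\<^bsub>G\<^esub> inv\<^bsub>G\<^esub> (cl ?v) = cl ?v \<otimes>\<^bsub>G\<^esub> inv\<^bsub>G\<^esub> (cl ?v)"
    using w cl_mult[of ?u "word_inv ?v"] by (simp add: cl_inv[symmetric])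
  then have "cl ?u = cl ?v" using c by (simp only: G.right_cancel G.inv_closed)
  then show ?thesis using \<phi>_rep_word[OF assms] by (simp add: \<iota>_cls)
qed

sublocale N: amalgam factor A \<phi>
  by (rule amalgam.intro) (rule group_factor group_A mon_\<phi>)+

text \<open>The relators identify the two images of the generators of \<open>A\<close> only; two homomorphisms that agree
  on generators agree everywhere.\<close>

lemma \<iota>_\<phi>:
  assumes "a \<in> carrier A"
  shows "\<iota> b (\<phi> b a) = \<iota> b' (\<phi> b' a)"
proof -
  interpret h: group_hom "factor b" G "\<iota> b" for b
    using group_factor group_G \<iota>_hom by (intro group_hom.intro group_hom_axioms.intro)
  have "a \<in> generate A Y" using assms generators_A by simp
  then have "\<iota> False (\<phi> False a) = \<iota> True (\<phi> True a)"
  proof induction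
    case one
    then show ?case by simp
  next
    case (incl a)
    then show ?case by (rule \<iota>_\<phi>_generator)
  next
    case (inv a)
    then show ?case using \<iota>_\<phi>_generator[OF inv] generators_A by (simp add: subset_iff)
  next
    case (eng a a')
    then show ?case using generators_A by simp
  qed
  then show ?thesis by (metis (full_types))
qed

definition tag :: "'x letter \<Rightarrow> bool \<times> 'x word set" where
  "tag l = (let b = (l \<in> letters X2) in (b, cls b [l]))"

lemma tag_factor: "l \<in> letters (gens b) \<Longrightarrow> tag l = (b, cls b [l])"
  using letters_gens by (simp add: tag_def)

lemma tag_tagged [simp]: "l \<in> letters X \<Longrightarrow> tag l \<in> N.tagged"
  by (erule letters_X_cases) (simp add: tag_factor carrier_factor)

lemma map_tag_tagged [simp]: "w \<in> words X \<Longrightarrow> map tag w \<in> lists N.tagged"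
  by (induction w) auto

lemma ev_tag: "w \<in> words X \<Longrightarrow> foldr (\<lambda>(b, g) y. \<iota> b g \<otimes>\<^bsub>G\<^esub> y) (map tag w) \<one>\<^bsub>G\<^esub> = cl w"
proof (induction w)
  case (Cons l w)
  then obtain b where b: "l \<in> letters (gens b)" by (auto elim: letters_X_cases)
  then have "\<iota> b (cls b [l]) = cl [l]" by (intro \<iota>_cls) simp
  then show ?case using Cons tag_factor[OF b] cl_mult[of "[l]" w] by simp
qed (simp add: cl_one)

lemma act_factor_word:
  assumes "w \<in> words (gens b)" "st \<in> N.states"
  shows "foldl N.act st (map tag w) = N.act st (b, cls b w)"
  using assms
proof (induction w arbitrary: st)
  case Nil
  then show ?case using N.act_one[of st b] by (simp add: cls_one del: N.act.simps)
next
  case (Cons l w)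
  then have l: "tag l = (b, cls b [l])" "cls b [l] \<in> carrier (factor b)" "cls b w \<in> carrier (factor b)"
    by (simp_all add: tag_factor[of l b] carrier_factor)
  then show ?case
    using Cons cls_mult[of "[l]" b w] N.act_mult[OF Cons.prems(2) l(2,3)]
      N.act_closed[OF Cons.prems(2), of "(b, cls b [l])"]
    by (simp del: N.act.simps N.act_closed)
qed

text \<open>The action on normal forms respects the defining relations of \<open>G\<close>: a cancelling pair of letters and
  the relators of a factor represent the identity of that factor, and \<open>\<phi> False a\<close>, \<open>\<phi> True a\<close> act alike.\<close>

lemma act_pres_eq:
  assumes "pres_eq X R u v" "st \<in> N.states"
  shows "foldl N.act st (map tag u) = foldl N.act st (map tag v)"
  using assms
proof (induction arbitrary: st)
  case (cancel u v l)
  define st' where "st' = foldl N.act st (map tag u)"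
  have st': "st' \<in> N.states" using cancel by (simp add: st'_def)
  obtain b where b: "l \<in> letters (gens b)" using cancel letters_X_cases by metis
  have "pres_eq (gens b) (rels b) ([] @ [l, letter_inv l] @ []) ([] @ [])"
    using b by (intro pres_eq.cancel) auto
  then have "cls b [l, letter_inv l] = \<one>\<^bsub>factor b\<^esub>" using b by (simp add: cls_one word_class_eq_iff)
  then have "foldl N.act st' (map tag [l, letter_inv l]) = st'"
    using act_factor_word[of "[l, letter_inv l]" b st'] b st' N.act_one by simp
  then show ?case by (simp add: st'_def)
next
  case (relator u v r)
  define st' where "st' = foldl N.act st (map tag u)"
  have st': "st' \<in> N.states" using relator by (simp add: st'_def)
  have "foldl N.act st' (map tag r) = st'"
  proof -
    consider b where "r \<in> rels b" | a where "a \<in> Y" "r = rep_word False a @ word_inv (rep_word True a)"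
      using relator by (auto simp: R_eq)
    then show ?thesis
    proof cases
      case 1
      then have r: "r \<in> words (gens b)" using rels_words by blast
      have "pres_eq (gens b) (rels b) ([] @ r @ []) ([] @ [])" using 1 by (intro pres_eq.relator) auto
      then have "cls b r = \<one>\<^bsub>factor b\<^esub>" using r by (simp add: cls_one word_class_eq_iff)
      then show ?thesis using act_factor_word[OF r st'] N.act_one[OF st'] by simp
    next
      case 2
      let ?u = "rep_word False a" and ?v = "rep_word True a"
      note w = \<phi>_rep_word[OF 2(1)]
      have a: "a \<in> carrier A" using 2 generators_A by auto
      have "foldl N.act st' (map tag ?u) = N.act st' (False, \<phi> False a)"
        using act_factor_word[OF w(1) st'] w(2) by simp
      also have "\<dots> = N.act st' (True, \<phi> True a)"
        using a st' by (simp add: N.act_\<phi> del: N.act.simps)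
      also have "\<dots> = foldl N.act st' (map tag ?v)"
        using act_factor_word[OF w(1) st'] w(2) by simp
      finally have "foldl N.act st' (map tag r) = foldl N.act st' (map tag (?v @ word_inv ?v))"
        using 2 by simp
      also have "\<dots> = N.act st' (True, cls True (?v @ word_inv ?v))"
        using w by (intro act_factor_word st') simp
      also have "cls True (?v @ word_inv ?v) = \<one>\<^bsub>factor True\<^esub>"
        using w(1)[of True] pres_eq_word_inv[of "word_inv ?v" "gens True" "rels True"]
        by (simp add: cls_one word_class_eq_iff)
      finally show ?thesis using N.act_one[OF st'] by simp
    qed
  qed
  then show ?case by (simp add: st'_def)
qed simp_all

lemma tagged_as_word:
  assumes "t \<in> lists N.tagged"
  shows "\<exists>w\<in>words X. cl w = foldr (\<lambda>(b, g) y. \<iota> b g \<otimes>\<^bsub>G\<^esub> y) t \<one>\<^bsub>G\<^esub> \<and>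
    (\<forall>st\<in>N.states. foldl N.act st (map tag w) = foldl N.act st t)"
  using assms
proof (induction t)
  case Nil
  then show ?case by (intro bexI[of _ "[]"]) (auto simp: cl_one)
next
  case (Cons x t)
  obtain b g where x: "x = (b, g)" by fastforce
  obtain u where u: "u \<in> words (gens b)" "g = cls b u" using Cons x by (auto simp: carrier_factor)
  obtain w where w: "w \<in> words X" "cl w = foldr (\<lambda>(b, g) y. \<iota> b g \<otimes>\<^bsub>G\<^esub> y) t \<one>\<^bsub>G\<^esub>"
    "\<And>st. st \<in> N.states \<Longrightarrow> foldl N.act st (map tag w) = foldl N.act st t"
    using Cons by auto
  have "g \<in> carrier (factor b)" using u by (auto simp: carrier_factor)
  then have "foldl N.act st (map tag (u @ w)) = foldl N.act st (x # t)" if "st \<in> N.states" for st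
    using that u w(3) x by (simp add: act_factor_word del: N.act.simps)
  moreover have "cl (u @ w) = \<iota> b g \<otimes>\<^bsub>G\<^esub> cl w" 
    using u w(1) words_mono[OF u(1)] by (simp add: \<iota>_cls cl_mult)
  ultimately show ?case
    using w(1,2) x words_mono[OF u(1)] by (intro bexI[of _ "u @ w"]) simp_all
qed

sublocale P: amalgamated_product factor A \<phi> G \<iota>
proof (intro amalgamated_product.intro amalgamated_product_axioms.intro)
  show "amalgam factor A \<phi>" by unfold_locales
  show "group G" by (rule group_G)
  show "\<iota> b \<in> hom (factor b) G" for b by (rule \<iota>_hom)
  show "\<iota> b (\<phi> b a) = \<iota> b' (\<phi> b' a)" if "a \<in> carrier A" for a b b' using that by (rule \<iota>_\<phi>)
  show "\<exists>w\<in>lists N.tagged. foldr (\<lambda>(b, g) y. \<iota> b g \<otimes>\<^bsub>G\<^esub> y) w \<one>\<^bsub>G\<^esub> = x"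
    if x: "x \<in> carrier G" for x
  proof -
    obtain w where "w \<in> words X" "x = cl w" using x by (auto simp: carrier_G)
    then show ?thesis by (intro bexI[of _ "map tag w"]) (simp_all only: ev_tag map_tag_tagged)
  qed
  fix u v
  assume uv: "u \<in> lists N.tagged" "v \<in> lists N.tagged"
    "foldr (\<lambda>(b, g) y. \<iota> b g \<otimes>\<^bsub>G\<^esub> y) u \<one>\<^bsub>G\<^esub> = foldr (\<lambda>(b, g) y. \<iota> b g \<otimes>\<^bsub>G\<^esub> y) v \<one>\<^bsub>G\<^esub>"
  obtain u' where u': "u' \<in> words X"
    "cl u' = foldr (\<lambda>(b, g) y. \<iota> b g \<otimes>\<^bsub>G\<^esub> y) u \<one>\<^bsub>G\<^esub>"
    "foldl N.act N.start (map tag u') = foldl N.act N.start u"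
    using tagged_as_word[OF uv(1)] N.start_states by blast
  obtain v' where v': "v' \<in> words X"
    "cl v' = foldr (\<lambda>(b, g) y. \<iota> b g \<otimes>\<^bsub>G\<^esub> y) v \<one>\<^bsub>G\<^esub>"
    "foldl N.act N.start (map tag v') = foldl N.act N.start v"
    using tagged_as_word[OF uv(2)] N.start_states by blast
  have "pres_eq X R u' v'" using u'(1,2) v'(2) uv(3) by (simp only: flip: word_class_eq_iff)
  from act_pres_eq[OF this N.start_states] show "foldl N.act N.start u = foldl N.act N.start v"
    unfolding u'(3) v'(3) .
qed

lemma finite_letters_X: "finite (letters X)"
  using finite_generators by (simp add: letters_def X_def)

lemma finite_tagged: "finite N.tagged"
proof -
  have "finite (carrier (factor b))" for b
    using finite_groups by (simp add: gens_def rels_def)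
  then have "finite (SIGMA b:UNIV. carrier (factor b))" by (intro finite_SigmaI) auto
  then show ?thesis by (rule finite_subset[rotated]) (auto simp: N.tagged_def)
qed

lemma finite_carrier_A: "finite (carrier A)"
  using mono(1) finite_groups(1)
  by (auto simp: mon_def hom_def intro: inj_on_finite)

lemma ev_word: "w \<in> words X \<Longrightarrow> P.ev (map tag w) = cl w"
  by (simp add: P.ev_def ev_tag)

lemma len_cl_le: "w \<in> words X \<Longrightarrow> P.len (cl w) \<le> length w"
  using P.len_ev_le[of "map tag w"] by (simp add: ev_word)

lemma normal_cl: "w \<in> words X \<Longrightarrow> P.normal (cl w) = foldl N.act N.start (map tag w)"
  using P.normal_ev[of "map tag w"] by (simp add: ev_word)

text \<open>The factors are finite, so some \<open>D\<close> bounds the lengths of suitable words for all their elements.\<close>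

lemma short_words_exist: "\<exists>D. \<forall>t\<in>lists N.tagged. \<exists>w\<in>words X. cl w = P.ev t \<and> length w \<le> D * length t"
proof -
  have "\<forall>x\<in>N.tagged. \<exists>w. w \<in> words X \<and> cl w = \<iota> (fst x) (snd x)"
    using words_mono \<iota>_cls by (fastforce simp: carrier_factor)
  then obtain f where f: "\<And>x. x \<in> N.tagged \<Longrightarrow> f x \<in> words X \<and> cl (f x) = \<iota> (fst x) (snd x)"
    by metis
  obtain D where D: "\<And>x. x \<in> N.tagged \<Longrightarrow> length (f x) \<le> D"
    using finite_imageI[OF finite_tagged, of "\<lambda>x. length (f x)"]
    unfolding finite_nat_set_iff_bounded_le by auto
  have "\<exists>w\<in>words X. cl w = P.ev t \<and> length w \<le> D * length t" if "t \<in> lists N.tagged" for t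
    using that
  proof (induction t)
    case Nil
    then show ?case by (intro bexI[of _ "[]"]) (auto simp: cl_one)
  next
    case (Cons x t)
    then obtain w where w: "w \<in> words X" "cl w = P.ev t" "length w \<le> D * length t" by auto
    obtain b g where x: "x = (b, g)" by fastforce
    have "cl (f x @ w) = P.ev (x # t)"
      using f[OF Cons.hyps(1)] w(1,2) by (simp add: x flip: cl_mult)
    then show ?case using f[OF Cons.hyps(1)] D[OF Cons.hyps(1)] w by (intro bexI[of _ "f x @ w"]) auto
  qed
  then show ?thesis by blast
qed

lemma cl_conjugate_iff:
  assumes "g \<in> words X" "k \<in> words X" "h \<in> words X"
  shows "P.conjugate (cl g) (cl k) = cl h \<longleftrightarrow> P.normal (cl (g @ k)) = P.normal (cl (h @ g))"
proof -
  have c: "cl w \<in> carrier G" if "w \<in> words X" for w using that by (simp add: carrier_G)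
  have "P.conjugate (cl g) (cl k) = cl h \<longleftrightarrow> cl g \<otimes>\<^bsub>G\<^esub> cl k = cl h \<otimes>\<^bsub>G\<^esub> cl g"
  proof
    assume "P.conjugate (cl g) (cl k) = cl h"
    then have "cl h \<otimes>\<^bsub>G\<^esub> cl g = P.conjugate (cl g) (cl k) \<otimes>\<^bsub>G\<^esub> cl g" by simp
    then show "cl g \<otimes>\<^bsub>G\<^esub> cl k = cl h \<otimes>\<^bsub>G\<^esub> cl g" using c assms by (simp add: P.G.m_assoc)
  next
    assume "cl g \<otimes>\<^bsub>G\<^esub> cl k = cl h \<otimes>\<^bsub>G\<^esub> cl g"
    then show "P.conjugate (cl g) (cl k) = cl h" using c assms by (simp add: P.G.m_assoc)
  qed
  also have "\<dots> \<longleftrightarrow> cl (g @ k) = cl (h @ g)" using assms by (simp add: cl_mult)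
  also have "\<dots> \<longleftrightarrow> P.normal (cl (g @ k)) = P.normal (cl (h @ g))"
    using assms by (intro P.normal_eq_iff[symmetric] c) simp_all
  finally show ?thesis .
qed

end

section \<open>The decision procedure\<close>

text \<open>Besides the given numbering of letters, the program needs numberings of the symbols occurring in
  states. Any injections will do: the symbols are finite in number and enter the program through tables.\<close>

locale coded_amalgam = finite_group_amalgam X1 X2 R1 R2 A Y \<phi>1 \<phi>2 w1 w2
  for X1 X2 :: "'x set"
    and R1 R2 :: "'x word set"
    and A :: "('a, 'm) monoid_scheme"
    and Y :: "'a set"
    and \<phi>1 \<phi>2 :: "'a \<Rightarrow> 'x word set"
    and w1 w2 :: "'a \<Rightarrow> 'x word" +
  fixes num :: "'x letter \<Rightarrow> nat"
    and ea :: "'a \<Rightarrow> nat"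
    and es :: "bool \<times> 'x word set \<Rightarrow> nat"
  assumes inj_num: "inj_on num (letters X)"
    and inj_ea: "inj_on ea (carrier A)"
    and inj_es: "inj_on es N.tagged"
begin

abbreviation state_code :: "'a \<times> (bool \<times> 'x word set) list \<Rightarrow> nat list" where
  "state_code st \<equiv> ea (fst st) # map es (snd st)"

lemma states_tagged: "(a, s) \<in> N.states \<Longrightarrow> a \<in> carrier A \<and> s \<in> lists N.tagged"
  by (auto simp: N.states_def dest: P.stack_tagged)

lemma inj_state_code: "inj_on state_code N.states"
proof (rule inj_onI)
  fix st st' assume st: "st \<in> N.states" "st' \<in> N.states" "state_code st = state_code st'"
  have t: "fst st \<in> carrier A" "fst st' \<in> carrier A" "snd st \<in> lists N.tagged" "snd st' \<in> lists N.tagged"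
    using st states_tagged[of "fst st" "snd st"] states_tagged[of "fst st'" "snd st'"] by auto
  have "fst st = fst st'" using st t inj_onD[OF inj_ea] by auto
  moreover have "snd st = snd st'"
    using st t inj_onD[OF inj_on_mapI[OF inj_on_subset[OF inj_es]], of "{snd st, snd st'}" "snd st" "snd st'"]
    by (auto simp: in_lists_conv_set)
  ultimately show "st = st'" by (simp add: prod_eq_iff)
qed

text \<open>The action of a letter on the state component in \<open>A\<close> and the top of the stack. Numbers that
  do not code a letter are ignored, so that every number codes a word and the search for a conjugator need
  not test its candidates.\<close>

definition rewrite_top :: "nat list \<Rightarrow> nat \<Rightarrow> nat list" where
  "rewrite_top c x = (if c \<in> state_code ` {st \<in> N.states. length (snd st) \<le> 1} \<and> x \<in> num ` letters X
    then state_code (N.act (inv_into N.states state_code c) (tag (inv_into (letters X) num x))) else c)"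

lemma finite_rewrite_top: "finite {(c, x). rewrite_top c x \<noteq> c}"
proof -
  have "{st \<in> N.states. length (snd st) \<le> 1} \<subseteq>
      carrier A \<times> {s. set s \<subseteq> N.tagged \<and> length s \<le> 1}"
    using states_tagged by (auto simp: in_lists_conv_set)
  then have "finite {st \<in> N.states. length (snd st) \<le> 1}"
    by (rule finite_subset)
      (intro finite_SigmaI finite_carrier_A finite_lists_length_le finite_tagged)
  then have "finite (state_code ` {st \<in> N.states. length (snd st) \<le> 1} \<times> num ` letters X)"
    by (intro finite_SigmaI finite_imageI finite_letters_X)
  then show ?thesis by (rule finite_subset[rotated]) (auto simp: rewrite_top_def split: if_splits)
qed

definition step :: "nat \<Rightarrow> nat \<Rightarrow> nat" where
  "step c x = list_encode (rewrite_top (take 2 (list_decode c)) x @ drop 2 (list_decode c))"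

lemma recursive_step: "recursive 2 (\<lambda>ys. step (ys ! 0) (ys ! 1))"
  unfolding step_def by (rule recursive_rewrite_prefix[OF finite_rewrite_top])

lemma step_letter:
  assumes st: "st \<in> N.states" and l: "l \<in> letters X"
  shows "step (list_encode (state_code st)) (num l) = list_encode (state_code (N.act st (tag l)))"
proof -
  obtain a s where as: "st = (a, s)" by fastforce
  define st1 where "st1 = (a, take 1 s)"
  have st1: "st1 \<in> N.states" using st N.stack_take by (auto simp: as st1_def N.states_def)
  have "take 2 (state_code st) = state_code st1" "drop 2 (state_code st) = map es (drop 1 s)"
    by (simp_all add: as st1_def numeral_2_eq_2 take_map drop_map)
  moreover have "rewrite_top (state_code st1) (num l) = state_code (N.act st1 (tag l))"
  proof -
    have "state_code st1 \<in> state_code ` {st \<in> N.states. length (snd st) \<le> 1}"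
      by (rule imageI) (use st1 in \<open>simp add: st1_def\<close>)
    then show ?thesis
      using l unfolding rewrite_top_def
      by (simp only: inv_into_f_f[OF inj_state_code st1] inv_into_f_f[OF inj_num l] imageI simp_thms if_True)
  qed
  moreover have "state_code (N.act st (tag l)) = state_code (N.act st1 (tag l)) @ map es (drop 1 s)"
    unfolding as N.act_local[of a s "tag l"] st1_def by (simp del: N.act.simps)
  ultimately show ?thesis by (simp only: step_def list_encode_inverse)
qed

lemma step_other: "x \<notin> num ` letters X \<Longrightarrow> step c x = c"
  by (simp add: step_def rewrite_top_def)

definition letters_of :: "nat list \<Rightarrow> 'x word" where
  "letters_of ns = map (inv_into (letters X) num) (filter (\<lambda>x. x \<in> num ` letters X) ns)"

lemma letters_of_words: "letters_of ns \<in> words X"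
  by (induction ns) (auto simp: letters_of_def inj_num)

lemma letters_of_num: "w \<in> words X \<Longrightarrow> letters_of (map num w) = w"
  by (induction w) (auto simp: letters_of_def inj_num)

definition run :: "nat \<Rightarrow> nat \<Rightarrow> nat" where
  "run c w = foldl step c (list_decode w)"

lemma run_state:
  assumes "st \<in> N.states"
  shows "run (list_encode (state_code st)) w =
    list_encode (state_code (foldl N.act st (map tag (letters_of (list_decode w)))))"
proof -
  have "foldl step (list_encode (state_code st)) ns =
      list_encode (state_code (foldl N.act st (map tag (letters_of ns))))" for ns
    using assms
  proof (induction ns arbitrary: st)
    case Nil
    then show ?case by (simp add: letters_of_def)
  next
    case (Cons x ns)
    show ?case
    proof (cases "x \<in> num ` letters X")
      case True
      then obtain l where l: "l \<in> letters X" "x = num l" by blast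
      have "letters_of (x # ns) = l # letters_of ns" using l inj_num by (simp add: letters_of_def)
      then show ?thesis
        using Cons.IH[of "N.act st (tag l)"] Cons.prems l step_letter[OF Cons.prems l(1)]
        by (simp del: N.act.simps list_encode.simps)
    next
      case False
      then show ?thesis
        using Cons.IH[of st] Cons.prems by (simp add: letters_of_def step_other del: list_encode.simps)
    qed
  qed
  then show ?thesis by (simp add: run_def)
qed

definition start_code :: nat where
  "start_code = list_encode (state_code N.start)"

text \<open>Running first on \<open>c\<close> and then on \<open>d\<close> treats the product of the two words without computing a
  concatenation of codes.\<close>

lemma run_run:
  assumes "u = letters_of (list_decode c)" "v = letters_of (list_decode d)"
  shows "run (run start_code c) d = list_encode (state_code (P.normal (cl (u @ v))))"
proof -
  have w: "u \<in> words X" "v \<in> words X" using assms letters_of_words by simp_all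
  then have "foldl N.act N.start (map tag u) \<in> N.states" by simp
  from run_state[OF this] show ?thesis
    unfolding start_code_def run_state[OF N.start_states] assms[symmetric]
    using w assms(2) by (simp add: normal_cl del: list_encode.simps)
qed

text \<open>The codes of \<open>k\<close> and \<open>h\<close> bound their lengths, so all elements on the path between them have length at
  most \<open>m\<close>, the sum of the codes. Such an element has a normal form with at most \<open>m + 1\<close> symbols, hence a code
  below \<open>N\<close>, so at most \<open>N * N\<close> steps are needed, each by a factor element given by a word of length at
  most \<open>D\<close>.\<close>

definition conjugator_bound :: "nat \<Rightarrow> nat \<Rightarrow> nat \<Rightarrow> nat" where
  "conjugator_bound K D m = (let N = Suc (code_bound K (Suc m)) in code_bound K (D * (N * N)))"

theorem conjugate_iff_bounded_search:
  "\<exists>K D. \<forall>k\<in>words X. \<forall>h\<in>words X.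
    (\<exists>g\<in>carrier G. P.conjugate g (cl k) = cl h) \<longleftrightarrow>
    (\<exists>c\<le>conjugator_bound K D (word_code num k + word_code num h).
      run (run start_code c) (word_code num k) = run (run start_code (word_code num h)) c)"
proof -
  obtain D where D: "\<And>t. t \<in> lists N.tagged \<Longrightarrow> \<exists>w\<in>words X. cl w = P.ev t \<and> length w \<le> D * length t"
    using short_words_exist by blast
  have "finite (num ` letters X \<union> ea ` carrier A \<union> es ` N.tagged)"
    using finite_letters_X finite_carrier_A finite_tagged by blast
  then obtain K where K: "\<And>x. x \<in> num ` letters X \<union> ea ` carrier A \<union> es ` N.tagged \<Longrightarrow> x \<le> K"
    unfolding finite_nat_set_iff_bounded_le by blast
  have key: "(\<exists>g\<in>carrier G. P.conjugate g (cl k) = cl h) \<longleftrightarrow>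
      (\<exists>c\<le>code_bound K (D * (N * N)).
        run (run start_code c) (word_code num k) = run (run start_code (word_code num h)) c)"
    if k: "k \<in> words X" and h: "h \<in> words X" and M: "M = word_code num k + word_code num h"
      and N: "N = Suc (code_bound K (Suc M))" for k h M N
  proof
    have search: "run (run start_code c) (word_code num k) = run (run start_code (word_code num h)) c
        \<longleftrightarrow> P.conjugate (cl w) (cl k) = cl h" if w: "w = letters_of (list_decode c)" for c w
    proof -
      have "w \<in> words X" using w letters_of_words by simp
      then have "P.normal (cl (w @ k)) \<in> N.states" "P.normal (cl (h @ w)) \<in> N.states"
        using k h by (auto intro!: P.normal_states simp: carrier_G)
      then have "state_code (P.normal (cl (w @ k))) = state_code (P.normal (cl (h @ w))) \<longleftrightarrow>
          P.normal (cl (w @ k)) = P.normal (cl (h @ w))"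
        using inj_on_eq_iff[OF inj_state_code] by blast
      also have "\<dots> \<longleftrightarrow> P.conjugate (cl w) (cl k) = cl h"
        using cl_conjugate_iff[OF \<open>w \<in> words X\<close> k h] by simp
      finally show ?thesis
        using w k h by (simp add: run_run[of w _ k] run_run[of h _ w] word_code_def letters_of_num
          list_encode_eq del: list_encode.simps)
    qed
    {
      assume "\<exists>g\<in>carrier G. P.conjugate g (cl k) = cl h"
      then obtain g where g: "g \<in> carrier G" "P.conjugate g (cl k) = cl h" by blast
      have len: "P.len (cl k) \<le> M" "P.len (cl h) \<le> M"
        using len_cl_le[OF k] len_cl_le[OF h] length_le_list_encode[of "map num k"]
          length_le_list_encode[of "map num h"] by (simp_all add: M word_code_def)
      have ck: "cl k \<in> carrier G" using k by (simp add: carrier_G)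
      define f where "f y = list_encode (state_code (P.normal y))" for y
      have inj: "inj_on f (carrier G)"
      proof (rule inj_onI)
        fix y z assume yz: "y \<in> carrier G" "z \<in> carrier G" "f y = f z"
        then have "P.normal y = P.normal z"
          using inj_onD[OF inj_state_code] P.normal_states by (simp add: f_def list_encode_eq del: list_encode.simps)
        then show "y = z" using P.normal_eq_iff yz(1,2) by blast
      qed
      have bound: "f y < N" if "y \<in> carrier G" "P.len y \<le> M" for y
      proof -
        have "fst (P.normal y) \<in> carrier A" "snd (P.normal y) \<in> lists N.tagged"
          using states_tagged[of "fst (P.normal y)" "snd (P.normal y)"] P.normal_states[OF that(1)] by auto
        then have "set (state_code (P.normal y)) \<subseteq> {..K}"
          using K by (auto simp: in_lists_conv_set)
        then show ?thesis
          using list_encode_le_code_bound[of "state_code (P.normal y)" K "Suc M"] that(2)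
          by (simp add: f_def N P.len_def less_Suc_eq_le del: list_encode.simps)
      qed
      obtain t where t: "t \<in> lists N.tagged" "length t \<le> N * N" "P.conjugate (P.ev t) (cl k) = cl h"
        using P.conjugate_bounded[OF ck g(1) len(1) _ inj bound] len(2) g(2) by auto
      obtain w where w: "w \<in> words X" "cl w = P.ev t" "length w \<le> D * length t"
        using D[OF t(1)] by blast
      have "length w \<le> D * (N * N)" using w(3) t(2) mult_le_mono2[OF t(2), of D] by linarith
      moreover have "set (map num w) \<subseteq> {..K}" using w(1) K by (auto simp: words_def in_lists_conv_set)
      ultimately have "word_code num w \<le> code_bound K (D * (N * N))"
        unfolding word_code_def by (intro list_encode_le_code_bound) auto
      moreover have "letters_of (list_decode (word_code num w)) = w"
        using w(1) by (simp add: word_code_def letters_of_num)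
      ultimately show "\<exists>c\<le>code_bound K (D * (N * N)).
          run (run start_code c) (word_code num k) = run (run start_code (word_code num h)) c"
        using search[of w "word_code num w"] t(3) w(2) by auto
    }
    assume "\<exists>c\<le>code_bound K (D * (N * N)).
        run (run start_code c) (word_code num k) = run (run start_code (word_code num h)) c"
    then show "\<exists>g\<in>carrier G. P.conjugate g (cl k) = cl h"
      using search letters_of_words by (auto simp: carrier_G)
  qed
  show ?thesis
    by (rule exI[of _ K], rule exI[of _ D]) (use key in \<open>unfold conjugator_bound_def Let_def, blast\<close>)
qed

theorem conjugacy_decidable:
  "\<exists>p. decides p num (words X) (\<lambda>k h. \<exists>g\<in>carrier G. P.conjugate g (cl k) = cl h)"
proof -
  obtain K D where KD: "\<And>k h. k \<in> words X \<Longrightarrow> h \<in> words X \<Longrightarrow>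
    (\<exists>g\<in>carrier G. P.conjugate g (cl k) = cl h) \<longleftrightarrow>
    (\<exists>c\<le>conjugator_bound K D (word_code num k + word_code num h).
      run (run start_code c) (word_code num k) = run (run start_code (word_code num h)) c)"
    using conjugate_iff_bounded_search by blast
  have "recursive 2 (\<lambda>xs. if \<exists>c\<le>conjugator_bound K D (xs ! 0 + xs ! 1).
      run (run start_code c) (xs ! 0) = run (run start_code (xs ! 1)) c then 1 else 0)"
    unfolding run_def conjugator_bound_def Let_def
    by (rule recursive_bounded_ex_eq) (intro rec_intros recursive_foldl[OF recursive_step]; simp)+
  then obtain p where p: "\<And>xs. length xs = 2 \<Longrightarrow>
    rec_eval p xs (if \<exists>c\<le>conjugator_bound K D (xs ! 0 + xs ! 1).
      run (run start_code c) (xs ! 0) = run (run start_code (xs ! 1)) c then 1 else 0)"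
    unfolding recursive_def by blast
  have "rec_eval p [word_code num k, word_code num h] (if \<exists>g\<in>carrier G. P.conjugate g (cl k) = cl h then 1 else 0)"
    if "k \<in> words X" "h \<in> words X" for k h
    using p[of "[word_code num k, word_code num h]"] unfolding KD[OF that] by simp
  then show ?thesis unfolding decides_def by blast
qed

end

theorem corollary5p21:
  fixes X1 X2 :: "'x set"
    and R1 R2 :: "'x word set"
    and A :: "('a, 'm) monoid_scheme"
    and Y :: "'a set"
    and \<phi>1 \<phi>2 :: "'a \<Rightarrow> 'x word set"
    and w1 w2 :: "'a \<Rightarrow> 'x word"
    and num :: "'x letter \<Rightarrow> nat"
  assumes "finite_group_amalgam X1 X2 R1 R2 A Y \<phi>1 \<phi>2 w1 w2"
    and "inj_on num (letters (X1 \<union> X2))"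
  shows "let X = X1 \<union> X2;
             R = amalgam_relators R1 R2 Y w1 w2;
             G = presented_group X R
         in \<exists>p. decides p num (words X)
              (\<lambda>k h. \<exists>g\<in>carrier G.
                 g \<otimes>\<^bsub>G\<^esub> word_class X R k \<otimes>\<^bsub>G\<^esub> inv\<^bsub>G\<^esub> g = word_class X R h)"
proof -
  interpret F: finite_group_amalgam X1 X2 R1 R2 A Y \<phi>1 \<phi>2 w1 w2 by (rule assms(1))
  obtain ea :: "'a \<Rightarrow> nat" where ea: "inj_on ea (carrier A)"
    using finite_imp_inj_to_nat_seg[OF F.finite_carrier_A] by blast
  obtain es :: "bool \<times> 'x word set \<Rightarrow> nat" where es: "inj_on es F.N.tagged"
    using finite_imp_inj_to_nat_seg[OF F.finite_tagged] by blast
  interpret C: coded_amalgam X1 X2 R1 R2 A Y \<phi>1 \<phi>2 w1 w2 num ea es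
    using assms ea es by unfold_locales (simp_all add: F.X_def)
  show ?thesis using C.conjugacy_decidable by (simp add: Let_def F.X_def F.R_def)
qed

end
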